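(* Let $G$ and $H$ be finitely generated groups, and suppose that $H$ is infinite. Then the restricted wreath product $G\wr H:=G^{(H)}\rtimes H$ preforms a non-abelian free group (that is, $G\wr H\rightsquigarrow\mathbb F_k$ for some $k\ge 2$) if and only if at least one of the following conditions holds: (1) $G$ does not satisfy any identity; (2) $H$ does not satisfy any almost-identity.
   Context: For finitely generated groups $G,H$, write $G\rightsquigarrow H$ ("$G$ preforms $H$") if there exist a finite generating set $T$ of $H$ and a sequence $S_1,S_2,\dots$ of finite generating sets of $G$, with bijections $S_n\to T$, such that for every $R\in\mathbb N$ and all $n$ large enough the balls of radius $R$ around the identity in the Cayley graphs of $(G,S_n)$ and $(H,T)$ are isomorphic as rooted graphs with edges labelled by generators, labels being identified via $S_n\to T$. $\mathbb F_k$ is the free group of rank $k$. $G^{(H)}$ denotes the group of finitely supported functions $H\to G$, on which $H$ acts by shifts. An identity for $G$ is a non-trivial element $w(x_1,\dots,x_n)$ of a free group with $w(g_1,\dots,g_n)=1$ for all $g_1,\dots,g_n\in G$. A non-trivial word $w\in\mathbb F_k$ is a $k$-almost-identity for a group $H$ if $w(h_1,\dots,h_k)=1$ for all $h_1,\dots,h_k\in H$ such that $\{h_1,\dots,h_k\}$ generates $H$. The group $H$ satisfies an almost-identity if for every integer $k\ge 2$ there exists a $k$-almost-identity for $H$; otherwise it does not satisfy any almost-identity. *)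

theory Defs
  imports "HOL-Algebra.Generated_Groups" "HOL-Algebra.Product_Groups"
begin

section \<open>Finitely generated groups\<close>

definition generating_set :: "('a, 'c) monoid_scheme \<Rightarrow> 'a set \<Rightarrow> bool" where
  "generating_set G S \<longleftrightarrow> S \<subseteq> carrier G \<and> generate G S = carrier G"

definition finitely_generated :: "('a, 'c) monoid_scheme \<Rightarrow> bool" where
  "finitely_generated G \<longleftrightarrow> (\<exists>S. finite S \<and> generating_set G S)"


section \<open>Free groups\<close>

text \<open>The letter \<open>(i, True)\<close> stands for the generator \<open>x\<^sub>i\<close>, and \<open>(i, False)\<close> for its inverse.
  Generators are numbered from 0.\<close>

type_synonym letter = "nat \<times> bool"

definition inv_letter :: "letter \<Rightarrow> letter" where
  "inv_letter a = (fst a, \<not> snd a)"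

definition reduced :: "letter list \<Rightarrow> bool" where
  "reduced w \<longleftrightarrow> successively (\<lambda>a b. b \<noteq> inv_letter a) w"

fun push :: "letter \<Rightarrow> letter list \<Rightarrow> letter list" where
  "push a [] = [a]"
| "push a (b # w) = (if b = inv_letter a then w else a # b # w)"

definition reduce :: "letter list \<Rightarrow> letter list" where
  "reduce w = foldr push w []"

definition free_group :: "nat \<Rightarrow> letter list monoid" where
  "free_group k =
    \<lparr>carrier = {w. reduced w \<and> fst ` set w \<subseteq> {..<k}},
     monoid.mult = (\<lambda>u v. reduce (u @ v)),
     one = []\<rparr>"

definition letter_eval :: "('a, 'c) monoid_scheme \<Rightarrow> (nat \<Rightarrow> 'a) \<Rightarrow> letter \<Rightarrow> 'a" where
  "letter_eval G g a = (if snd a then g (fst a) else inv\<^bsub>G\<^esub> g (fst a))"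

definition word_eval :: "('a, 'c) monoid_scheme \<Rightarrow> (nat \<Rightarrow> 'a) \<Rightarrow> letter list \<Rightarrow> 'a" where
  "word_eval G g w = foldr (\<lambda>a x. letter_eval G g a \<otimes>\<^bsub>G\<^esub> x) w \<one>\<^bsub>G\<^esub>"

lemma inv_letter_simps [simp]:
  "inv_letter (inv_letter a) = a" "fst (inv_letter a) = fst a" "inv_letter a \<noteq> a"
  by (auto simp: inv_letter_def prod_eq_iff)

lemma reduced_simps [simp]:
  "reduced []" "reduced [a]"
  "reduced (a # b # w) \<longleftrightarrow> b \<noteq> inv_letter a \<and> reduced (b # w)"
  by (auto simp: reduced_def)

lemma reduced_ConsD: "reduced (a # w) \<Longrightarrow> reduced w"
  by (cases w) auto

lemma reduced_push: "reduced w \<Longrightarrow> reduced (push a w)"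
  by (cases w) (auto dest: reduced_ConsD)

lemma reduced_foldr_push: "reduced w \<Longrightarrow> reduced (foldr push u w)"
  by (induction u) (auto intro: reduced_push)

lemma push_eq_Cons: "reduced (a # w) \<Longrightarrow> push a w = a # w"
  by (cases w) auto

lemma push_inv_push: "reduced w \<Longrightarrow> push a (push (inv_letter a) w) = w"
  by (cases w) (auto simp: push_eq_Cons)

lemma reduce_eq_self: "reduced w \<Longrightarrow> reduce w = w"
proof (induction w)
  case (Cons a w)
  then show ?case
    using reduced_ConsD[OF Cons.prems] by (simp add: reduce_def push_eq_Cons)
qed (simp add: reduce_def)

lemma foldr_push_push:
  assumes "reduced v"
  shows "foldr push (push a w) v = push a (foldr push w v)"
  using assms by (cases w) (auto simp: push_inv_push reduced_foldr_push)

lemma foldr_push_reduce: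
  "reduced v \<Longrightarrow> foldr push (reduce u) v = foldr push u v"
  by (induction u) (auto simp: reduce_def foldr_push_push)

lemma set_push: "fst ` set (push a w) \<subseteq> insert (fst a) (fst ` set w)"
  by (cases w) auto

lemma set_reduce: "fst ` set (reduce w) \<subseteq> fst ` set w"
proof (induction w)
  case (Cons a w)
  have "fst ` set (reduce (a # w)) \<subseteq> insert (fst a) (fst ` set (reduce w))"
    using set_push[of a "reduce w"] by (simp add: reduce_def)
  also have "\<dots> \<subseteq> fst ` set (a # w)" using Cons by auto
  finally show ?case .
qed (simp add: reduce_def)

lemma reduce_append: "reduced v \<Longrightarrow> reduce (u @ v) = foldr push u v"
  using reduce_eq_self[of v] by (simp add: reduce_def)

lemma reduced_reduce: "reduced (reduce u)"
  by (simp add: reduce_def reduced_foldr_push)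

lemma foldr_push_inverse:
  "reduced v \<Longrightarrow> foldr push (map inv_letter (rev w)) (foldr push w v) = v"
proof (induction w arbitrary: v)
  case (Cons a w)
  have "reduced (foldr push w v)" using Cons.prems by (rule reduced_foldr_push)
  then have "push (inv_letter a) (push a (foldr push w v)) = foldr push w v"
    using push_inv_push[of _ "inv_letter a"] by simp
  then show ?case using Cons by simp
qed simp

lemma group_free_group: "group (free_group k)"
proof (rule groupI)
  fix x y z
  assume x: "x \<in> carrier (free_group k)" and y: "y \<in> carrier (free_group k)"
  show "x \<otimes>\<^bsub>free_group k\<^esub> y \<in> carrier (free_group k)"
    using x y subset_trans[OF set_reduce[of "x @ y"], of "{..<k}"]
    by (simp add: free_group_def reduced_reduce image_Un)
  assume z: "z \<in> carrier (free_group k)"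
  have "reduce (reduce (x @ y) @ z) = foldr push (x @ y) z"
    using z by (simp add: free_group_def reduce_append foldr_push_reduce del: foldr_append)
  moreover have "reduce (x @ reduce (y @ z)) = foldr push (x @ y) z"
    using z by (simp add: free_group_def reduce_append reduced_reduce reduced_foldr_push)
  ultimately show "x \<otimes>\<^bsub>free_group k\<^esub> y \<otimes>\<^bsub>free_group k\<^esub> z = x \<otimes>\<^bsub>free_group k\<^esub> (y \<otimes>\<^bsub>free_group k\<^esub> z)"
    by (simp add: free_group_def)
next
  show "\<one>\<^bsub>free_group k\<^esub> \<in> carrier (free_group k)" by (simp add: free_group_def)
next
  fix x assume x: "x \<in> carrier (free_group k)"
  show "\<one>\<^bsub>free_group k\<^esub> \<otimes>\<^bsub>free_group k\<^esub> x = x"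
    using x by (simp add: free_group_def reduce_eq_self)
  let ?y = "reduce (map inv_letter (rev x))"
  have "foldr push (map inv_letter (rev x)) (foldr push x []) = []"
    by (rule foldr_push_inverse) simp
  moreover have "foldr push x [] = x"
    using x reduce_eq_self[of x] by (simp add: free_group_def reduce_def)
  ultimately have "reduce (?y @ x) = []"
    using x by (simp add: free_group_def reduce_append foldr_push_reduce)
  moreover have "fst ` set ?y \<subseteq> fst ` set x"
    using set_reduce[of "map inv_letter (rev x)"] by force
  ultimately show "\<exists>y\<in>carrier (free_group k). y \<otimes>\<^bsub>free_group k\<^esub> x = \<one>\<^bsub>free_group k\<^esub>"
    using x by (intro bexI[of _ ?y]) (auto simp: free_group_def reduced_reduce)
qed


section \<open>Identities and almost-identities\<close>

definition is_identity :: "('a, 'c) monoid_scheme \<Rightarrow> nat \<Rightarrow> letter list \<Rightarrow> bool" where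
  "is_identity G n w \<longleftrightarrow>
    w \<in> carrier (free_group n) \<and> w \<noteq> \<one>\<^bsub>free_group n\<^esub> \<and>
    (\<forall>g. g ` {..<n} \<subseteq> carrier G \<longrightarrow> word_eval G g w = \<one>\<^bsub>G\<^esub>)"

definition satisfies_identity :: "('a, 'c) monoid_scheme \<Rightarrow> bool" where
  "satisfies_identity G \<longleftrightarrow> (\<exists>n w. is_identity G n w)"

definition is_almost_identity :: "('a, 'c) monoid_scheme \<Rightarrow> nat \<Rightarrow> letter list \<Rightarrow> bool" where
  "is_almost_identity H k w \<longleftrightarrow>
    w \<in> carrier (free_group k) \<and> w \<noteq> \<one>\<^bsub>free_group k\<^esub> \<and>
    (\<forall>h. generating_set H (h ` {..<k}) \<longrightarrow> word_eval H h w = \<one>\<^bsub>H\<^esub>)"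

definition satisfies_almost_identity :: "('a, 'c) monoid_scheme \<Rightarrow> bool" where
  "satisfies_almost_identity H \<longleftrightarrow> (\<forall>k\<ge>2. \<exists>w. is_almost_identity H k w)"


section \<open>Restricted wreath products\<close>

definition semidirect_product ::
    "('n, 'c) monoid_scheme \<Rightarrow> ('h, 'd) monoid_scheme \<Rightarrow> ('h \<Rightarrow> 'n \<Rightarrow> 'n) \<Rightarrow> ('n \<times> 'h) monoid" where
  "semidirect_product N H \<phi> =
    \<lparr>carrier = carrier N \<times> carrier H,
     monoid.mult = (\<lambda>(x, g) (y, h). (x \<otimes>\<^bsub>N\<^esub> \<phi> g y, g \<otimes>\<^bsub>H\<^esub> h)),
     one = (\<one>\<^bsub>N\<^esub>, \<one>\<^bsub>H\<^esub>)\<rparr>"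

definition shift :: "('h, 'd) monoid_scheme \<Rightarrow> 'h \<Rightarrow> ('h \<Rightarrow> 'g) \<Rightarrow> 'h \<Rightarrow> 'g" where
  "shift H h f = (\<lambda>x\<in>carrier H. f (inv\<^bsub>H\<^esub> h \<otimes>\<^bsub>H\<^esub> x))"

text \<open>For groups \<open>G\<close>, the carrier of \<^term>\<open>sum_group (carrier H) (\<lambda>_. G)\<close> consists of the finitely
  supported functions from \<open>H\<close> to \<open>G\<close>.\<close>

definition wreath_product ::
    "('g, 'c) monoid_scheme \<Rightarrow> ('h, 'd) monoid_scheme \<Rightarrow> (('h \<Rightarrow> 'g) \<times> 'h) monoid" where
  "wreath_product G H = semidirect_product (sum_group (carrier H) (\<lambda>_. G)) H (shift H)"

lemma group_semidirect_product:
  assumes N: "group N" and H: "group H"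
    and closed: "\<And>g x. g \<in> carrier H \<Longrightarrow> x \<in> carrier N \<Longrightarrow> \<phi> g x \<in> carrier N"
    and hom: "\<And>g x y. g \<in> carrier H \<Longrightarrow> x \<in> carrier N \<Longrightarrow> y \<in> carrier N \<Longrightarrow>
                \<phi> g (x \<otimes>\<^bsub>N\<^esub> y) = \<phi> g x \<otimes>\<^bsub>N\<^esub> \<phi> g y"
    and act: "\<And>g h x. g \<in> carrier H \<Longrightarrow> h \<in> carrier H \<Longrightarrow> x \<in> carrier N \<Longrightarrow>
                \<phi> (g \<otimes>\<^bsub>H\<^esub> h) x = \<phi> g (\<phi> h x)"
    and one: "\<And>x. x \<in> carrier N \<Longrightarrow> \<phi> \<one>\<^bsub>H\<^esub> x = x"
  shows "group (semidirect_product N H \<phi>)"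
proof -
  interpret N: group N by fact
  interpret H: group H by fact
  show ?thesis
  proof (rule groupI, goal_cases)
    case (5 p)
    then obtain x g where p: "p = (x, g)" "x \<in> carrier N" "g \<in> carrier H"
      by (auto simp: semidirect_product_def)
    let ?q = "(\<phi> (inv\<^bsub>H\<^esub> g) (inv\<^bsub>N\<^esub> x), inv\<^bsub>H\<^esub> g)"
    have "\<phi> (inv\<^bsub>H\<^esub> g) (inv\<^bsub>N\<^esub> x) \<otimes>\<^bsub>N\<^esub> \<phi> (inv\<^bsub>H\<^esub> g) x = \<phi> (inv\<^bsub>H\<^esub> g) \<one>\<^bsub>N\<^esub>"
      using p hom[of "inv\<^bsub>H\<^esub> g" "inv\<^bsub>N\<^esub> x" x] by simp
    also have "\<dots> = \<one>\<^bsub>N\<^esub>"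
      using p hom[of "inv\<^bsub>H\<^esub> g" "\<one>\<^bsub>N\<^esub>" "\<one>\<^bsub>N\<^esub>"] closed[of "inv\<^bsub>H\<^esub> g" "\<one>\<^bsub>N\<^esub>"]
      by (metis H.inv_closed N.l_cancel_one N.one_closed N.r_one)
    finally show ?case
      using p closed by (intro bexI[of _ ?q]) (auto simp: semidirect_product_def)
  qed (auto simp: semidirect_product_def closed hom act one N.m_assoc H.m_assoc)
qed

lemma group_wreath_product:
  assumes G: "group G" and H: "group H"
  shows "group (wreath_product G H)"
proof -
  interpret G: group G by fact
  interpret H: group H by fact
  let ?N = "sum_group (carrier H) (\<lambda>_. G)"
  have carrier: "carrier ?N = {x \<in> carrier H \<rightarrow>\<^sub>E carrier G. finite {i \<in> carrier H. x i \<noteq> \<one>\<^bsub>G\<^esub>}}"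
    by (simp add: carrier_sum_group G)
  show ?thesis
    unfolding wreath_product_def
  proof (rule group_semidirect_product)
    show "group ?N" by (simp add: G)
    show "group H" by fact
  next
    fix h f assume h: "h \<in> carrier H" and f: "f \<in> carrier ?N"
    have "{i \<in> carrier H. shift H h f i \<noteq> \<one>\<^bsub>G\<^esub>} \<subseteq>
        (\<lambda>x. h \<otimes>\<^bsub>H\<^esub> x) ` {i \<in> carrier H. f i \<noteq> \<one>\<^bsub>G\<^esub>}"
    proof
      fix i assume i: "i \<in> {i \<in> carrier H. shift H h f i \<noteq> \<one>\<^bsub>G\<^esub>}"
      then have "i = h \<otimes>\<^bsub>H\<^esub> (inv\<^bsub>H\<^esub> h \<otimes>\<^bsub>H\<^esub> i)"
        using h by (simp add: H.m_assoc[symmetric])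
      then show "i \<in> (\<lambda>x. h \<otimes>\<^bsub>H\<^esub> x) ` {i \<in> carrier H. f i \<noteq> \<one>\<^bsub>G\<^esub>}"
        using i h by (intro image_eqI) (auto simp: shift_def)
    qed
    then have "finite {i \<in> carrier H. shift H h f i \<noteq> \<one>\<^bsub>G\<^esub>}"
      using f by (auto simp: carrier intro: finite_subset)
    then show "shift H h f \<in> carrier ?N"
      using h f by (auto simp: carrier shift_def PiE_iff)
  next
    fix h f f' assume "h \<in> carrier H" "f \<in> carrier ?N" "f' \<in> carrier ?N"
    then show "shift H h (f \<otimes>\<^bsub>?N\<^esub> f') = shift H h f \<otimes>\<^bsub>?N\<^esub> shift H h f'"
      by (auto simp: shift_def)
  next
    fix g h f assume "g \<in> carrier H" "h \<in> carrier H" "f \<in> carrier ?N"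
    then show "shift H (g \<otimes>\<^bsub>H\<^esub> h) f = shift H g (shift H h f)"
      by (auto simp: shift_def fun_eq_iff H.inv_mult_group H.m_assoc)
  next
    fix f assume "f \<in> carrier ?N"
    then show "shift H \<one>\<^bsub>H\<^esub> f = f"
      by (auto simp: carrier shift_def fun_eq_iff PiE_iff extensional_def)
  qed
qed


section \<open>Cayley graphs and the preform relation\<close>

text \<open>An edge \<open>(u, s, v)\<close> goes from \<open>u\<close> to \<open>v\<close> and carries the label \<open>s\<close>.\<close>

record ('v, 'l) rooted_graph =
  g_verts :: "'v set"
  g_edges :: "('v \<times> 'l \<times> 'v) set"
  g_root :: 'v

definition cayley_graph :: "('a, 'c) monoid_scheme \<Rightarrow> 'a set \<Rightarrow> ('a, 'a) rooted_graph" where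
  "cayley_graph G S =
    \<lparr>g_verts = carrier G,
     g_edges = {(g, s, g \<otimes>\<^bsub>G\<^esub> s) | g s. g \<in> carrier G \<and> s \<in> S},
     g_root = \<one>\<^bsub>G\<^esub>\<rparr>"

text \<open>Distances in a Cayley graph ignore the orientation of the edges, because generating sets are not
  assumed to be symmetric. A ball is the subgraph induced on the vertices at distance at most \<open>R\<close> from
  the root.\<close>

definition adjacent :: "('v, 'l) rooted_graph \<Rightarrow> ('v \<times> 'v) set" where
  "adjacent X = {(u, v). \<exists>s. (u, s, v) \<in> g_edges X \<or> (v, s, u) \<in> g_edges X}"

definition ball_verts :: "('v, 'l) rooted_graph \<Rightarrow> nat \<Rightarrow> 'v set" where
  "ball_verts X R = {v \<in> g_verts X. \<exists>n\<le>R. (g_root X, v) \<in> adjacent X ^^ n}"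

definition graph_ball :: "('v, 'l) rooted_graph \<Rightarrow> nat \<Rightarrow> ('v, 'l) rooted_graph" where
  "graph_ball X R =
    \<lparr>g_verts = ball_verts X R,
     g_edges = {(u, s, v) \<in> g_edges X. u \<in> ball_verts X R \<and> v \<in> ball_verts X R},
     g_root = g_root X\<rparr>"

text \<open>Isomorphism of rooted edge-labelled graphs, with labels identified via the bijection \<open>\<beta>\<close>.\<close>

definition rooted_graph_iso ::
    "('l \<Rightarrow> 'm) \<Rightarrow> ('v, 'l) rooted_graph \<Rightarrow> ('w, 'm) rooted_graph \<Rightarrow> bool" where
  "rooted_graph_iso \<beta> X Y \<longleftrightarrow>
    (\<exists>\<phi>. bij_betw \<phi> (g_verts X) (g_verts Y) \<and>
         \<phi> (g_root X) = g_root Y \<and>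
         g_edges Y = (\<lambda>(u, s, v). (\<phi> u, \<beta> s, \<phi> v)) ` g_edges X)"

definition preforms :: "('a, 'c) monoid_scheme \<Rightarrow> ('b, 'd) monoid_scheme \<Rightarrow> bool" where
  "preforms G H \<longleftrightarrow>
    (\<exists>T S \<beta>.
      finite T \<and> generating_set H T \<and>
      (\<forall>n::nat. finite (S n) \<and> generating_set G (S n) \<and> bij_betw (\<beta> n) (S n) T) \<and>
      (\<forall>R::nat. \<exists>n0. \<forall>n\<ge>n0.
        rooted_graph_iso (\<beta> n)
          (graph_ball (cayley_graph G (S n)) R) (graph_ball (cayley_graph H T) R)))"

end

theory Submission
  imports Defs
begin

text \<open>A group preforms \<open>F\<^sub>k\<close> if and only if it satisfies no \<open>k\<close>-almost-identity:
  isomorphisms of large balls preserve the values of short words, and finitely many non-trivial words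
  can be combined into a single one by commutators. Since \<open>k \<ge> 2\<close>, every non-trivial word in more
  than \<open>k\<close> letters stays non-trivial after substituting suitable elements of \<open>F\<^sub>k\<close> for the
  additional letters, so additional letters can be used freely.

  If \<open>u\<close> is an identity of \<open>G\<close> and \<open>v\<close> an almost-identity of \<open>H\<close>, then substituting
  products of conjugates of \<open>v\<close> into \<open>u\<close> gives an almost-identity of the wreath product, because
  \<open>v\<close> takes its values on generating tuples in the base group. If \<open>H\<close> satisfies no
  \<open>k\<close>-almost-identity, then neither does any finitely generated extension, after adding as many
  letters as the extension has generators. If \<open>w\<close> is not an identity of \<open>G\<close>, choose
  \<open>w(g\<^sub>1, \<dots>, g\<^sub>m) \<noteq> 1\<close> and look for a generating tuple of the wreath product whose \<open>i\<close>-th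
  member has a base component equal to \<open>g\<^sub>i\<close> on a large ball \<open>B\<close> of \<open>H\<close>; then the value of
  \<open>w\<close> at this tuple has \<open>w(g\<^sub>1, \<dots>, g\<^sub>m)\<close> as a coordinate. As \<open>H\<close> is infinite, the remaining
  values, far away from \<open>B\<close>, can be used to make the tuple generate.\<close>

section \<open>Words and their values\<close>

definition inv_word :: "letter list \<Rightarrow> letter list" where
  "inv_word w = map inv_letter (rev w)"

lemma inv_word_simps [simp]:
  "inv_word [] = []" "inv_word (a # w) = inv_word w @ [inv_letter a]"
  "inv_word (u @ v) = inv_word v @ inv_word u"
  "length (inv_word w) = length w" "inv_word (inv_word w) = w"
  "inv_word w = [] \<longleftrightarrow> w = []"
  by (auto simp: inv_word_def rev_map comp_def)

lemma fst_set_inv_word [simp]: "fst ` set (inv_word w) = fst ` set w"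
  by (auto simp: inv_word_def image_image)

lemma reduced_append:
  "reduced (u @ v) \<longleftrightarrow>
    reduced u \<and> reduced v \<and> (u \<noteq> [] \<longrightarrow> v \<noteq> [] \<longrightarrow> hd v \<noteq> inv_letter (last u))"
  by (auto simp: reduced_def successively_append_iff)

lemma reduced_Cons: "reduced (a # w) \<longleftrightarrow> reduced w \<and> (w \<noteq> [] \<longrightarrow> hd w \<noteq> inv_letter a)"
  using reduced_append[of "[a]" w] by auto

lemma reduced_inv_word [simp]: "reduced (inv_word w) \<longleftrightarrow> reduced w"
proof -
  have "reduced (inv_word w)" if "reduced w" for w
    using that
  proof (induction w)
    case (Cons a w)
    then show ?case
      by (cases w) (auto simp: reduced_append reduced_Cons)
  qed simp
  from this this[of "inv_word w"] show ?thesis by auto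
qed

lemma word_eval_simps [simp]:
  "word_eval G g [] = \<one>\<^bsub>G\<^esub>"
  "word_eval G g (a # w) = letter_eval G g a \<otimes>\<^bsub>G\<^esub> word_eval G g w"
  by (simp_all add: word_eval_def)

lemma letter_eval_cong: "g (fst a) = h (fst a) \<Longrightarrow> letter_eval G g a = letter_eval G h a"
  by (simp add: letter_eval_def)

lemma word_eval_cong:
  "(\<And>i. i \<in> fst ` set w \<Longrightarrow> g i = h i) \<Longrightarrow> word_eval G g w = word_eval G h w"
  by (induction w) (auto intro: arg_cong2[where f = "mult G"] letter_eval_cong)

context group
begin

lemma letter_eval_closed [simp]:
  "g \<in> I \<rightarrow> carrier G \<Longrightarrow> fst a \<in> I \<Longrightarrow> letter_eval G g a \<in> carrier G"
  by (auto simp: letter_eval_def)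

lemma letter_eval_inv_letter:
  "g \<in> I \<rightarrow> carrier G \<Longrightarrow> fst a \<in> I \<Longrightarrow> letter_eval G g (inv_letter a) = inv (letter_eval G g a)"
  by (auto simp: letter_eval_def inv_letter_def Pi_iff)

lemma word_eval_closed [simp]:
  "g \<in> I \<rightarrow> carrier G \<Longrightarrow> fst ` set w \<subseteq> I \<Longrightarrow> word_eval G g w \<in> carrier G"
  by (induction w) auto

lemma word_eval_append:
  "g \<in> I \<rightarrow> carrier G \<Longrightarrow> fst ` set u \<subseteq> I \<Longrightarrow> fst ` set v \<subseteq> I \<Longrightarrow>
    word_eval G g (u @ v) = word_eval G g u \<otimes> word_eval G g v"
  by (induction u) (auto simp: m_assoc image_subset_iff Pi_iff)

lemma word_eval_inv_word:
  "g \<in> I \<rightarrow> carrier G \<Longrightarrow> fst ` set w \<subseteq> I \<Longrightarrow> word_eval G g (inv_word w) = inv (word_eval G g w)"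
proof (induction w)
  case (Cons a w)
  then have "word_eval G g (inv_word w @ [inv_letter a]) =
      word_eval G g (inv_word w) \<otimes> word_eval G g [inv_letter a]"
    by (intro word_eval_append) auto
  with Cons show ?case
    by (simp add: letter_eval_inv_letter[of g I] inv_mult_group)
qed simp

lemma word_eval_push:
  assumes "g \<in> I \<rightarrow> carrier G" "fst a \<in> I" "fst ` set w \<subseteq> I"
  shows "word_eval G g (push a w) = letter_eval G g a \<otimes> word_eval G g w"
proof (cases "\<exists>v. w = inv_letter a # v")
  case True
  with assms show ?thesis
    by (auto simp: letter_eval_inv_letter[of g I] m_assoc[symmetric])
next
  case False
  then have "push a w = a # w" by (cases w) auto
  then show ?thesis by simp
qed

lemma word_eval_reduce:
  assumes "g \<in> I \<rightarrow> carrier G" "fst ` set w \<subseteq> I"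
  shows "word_eval G g (reduce w) = word_eval G g w"
  using assms(2)
proof (induction w)
  case (Cons a w)
  have "word_eval G g (reduce (a # w)) = word_eval G g (push a (reduce w))"
    by (simp add: reduce_def)
  also have "\<dots> = letter_eval G g a \<otimes> word_eval G g (reduce w)"
    using Cons.prems assms(1) subset_trans[OF set_reduce[of w], of I]
    by (intro word_eval_push) auto
  finally show ?case using Cons by simp
qed (simp add: reduce_def)

lemma generate_eq_word_eval:
  assumes g: "g \<in> I \<rightarrow> carrier G"
  shows "generate G (g ` I) = {word_eval G g w | w. fst ` set w \<subseteq> I}"
proof (intro equalityI subsetI)
  fix x assume "x \<in> generate G (g ` I)"
  then have "\<exists>w. x = word_eval G g w \<and> fst ` set w \<subseteq> I"
  proof (induction rule: generate.induct)
    case one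
    then show ?case by (intro exI[of _ "[]"]) simp
  next
    case (incl h)
    then obtain i where "i \<in> I" "h = g i" by auto
    then show ?case using g by (intro exI[of _ "[(i, True)]"]) (auto simp: letter_eval_def Pi_iff)
  next
    case (inv h)
    then obtain i where "i \<in> I" "h = g i" by auto
    then show ?case using g by (intro exI[of _ "[(i, False)]"]) (auto simp: letter_eval_def Pi_iff)
  next
    case (eng h1 h2)
    then obtain u v where "h1 = word_eval G g u" "fst ` set u \<subseteq> I"
      "h2 = word_eval G g v" "fst ` set v \<subseteq> I" by auto
    then show ?case using g
      by (intro exI[of _ "u @ v"]) (auto simp: word_eval_append[of g I])
  qed
  then show "x \<in> {word_eval G g w | w. fst ` set w \<subseteq> I}" by auto
next
  fix x assume "x \<in> {word_eval G g w | w. fst ` set w \<subseteq> I}"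
  then obtain w where "x = word_eval G g w" "fst ` set w \<subseteq> I" by auto
  moreover have "word_eval G g w \<in> generate G (g ` I)" if "fst ` set w \<subseteq> I" for w
    using that
  proof (induction w)
    case (Cons a w)
    then have "g (fst a) \<in> g ` I" by auto
    then have "letter_eval G g a \<in> generate G (g ` I)"
      by (auto simp: letter_eval_def intro: generate.intros)
    with Cons show ?case by (auto intro: generate.eng)
  qed (auto intro: generate.one)
  ultimately show "x \<in> generate G (g ` I)" by simp
qed

lemma generating_set_iff_word_eval:
  "generating_set G (g ` I) \<longleftrightarrow>
    g \<in> I \<rightarrow> carrier G \<and> (\<forall>x\<in>carrier G. \<exists>w. fst ` set w \<subseteq> I \<and> word_eval G g w = x)"
    (is "_ \<longleftrightarrow> ?R")
proof
  assume gen: "generating_set G (g ` I)"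
  then have g: "g \<in> I \<rightarrow> carrier G" by (auto simp: generating_set_def)
  have "\<exists>w. fst ` set w \<subseteq> I \<and> word_eval G g w = x" if "x \<in> carrier G" for x
  proof -
    have "x \<in> generate G (g ` I)" using gen that by (simp add: generating_set_def)
    then show ?thesis unfolding generate_eq_word_eval[OF g] by auto
  qed
  with g show ?R by simp
next
  assume R: ?R
  then have g: "g \<in> I \<rightarrow> carrier G" by simp
  have "x \<in> generate G (g ` I)" if "x \<in> carrier G" for x
  proof -
    from R that obtain w where "fst ` set w \<subseteq> I" "word_eval G g w = x" by metis
    then show ?thesis unfolding generate_eq_word_eval[OF g] by auto
  qed
  moreover have "generate G (g ` I) \<subseteq> carrier G"
    using g by (intro generate_incl) auto
  ultimately show "generating_set G (g ` I)"
    using g by (auto simp: generating_set_def)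
qed

lemma word_eval_hom:
  assumes "group H" "\<phi> \<in> hom G H" "g \<in> I \<rightarrow> carrier G" "fst ` set w \<subseteq> I"
  shows "word_eval H (\<lambda>i. \<phi> (g i)) w = \<phi> (word_eval G g w)"
proof -
  interpret \<phi>: group_hom G H \<phi>
    using assms by (simp add: group_hom_def group_hom_axioms_def)
  show ?thesis
    using assms(4)
  proof (induction w)
    case (Cons a w)
    have "letter_eval H (\<lambda>i. \<phi> (g i)) a = \<phi> (letter_eval G g a)"
      using Cons.prems assms(3) by (auto simp: letter_eval_def Pi_iff)
    with Cons assms(3) show ?case by (simp add: letter_eval_closed[of g I] word_eval_closed[of g I])
  qed simp
qed

end

section \<open>Evaluation of words and free groups\<close>

lemma carrier_free_group: "carrier (free_group k) = {w. reduced w \<and> fst ` set w \<subseteq> {..<k}}"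
  and mult_free_group: "u \<otimes>\<^bsub>free_group k\<^esub> v = reduce (u @ v)"
  and one_free_group: "\<one>\<^bsub>free_group k\<^esub> = []"
  by (simp_all add: free_group_def)

lemma inv_free_group:
  assumes "w \<in> carrier (free_group k)"
  shows "inv\<^bsub>free_group k\<^esub> w = inv_word w"
proof -
  interpret F: group "free_group k" by (rule group_free_group)
  have "reduce (inv_word w @ w) = []"
    using assms foldr_push_inverse[of "[]" w] reduce_append[of w "inv_word w"] reduce_eq_self[of w]
    by (simp add: carrier_free_group inv_word_def reduce_def)
  with assms show ?thesis
    by (intro F.inv_equality) (auto simp: carrier_free_group mult_free_group one_free_group)
qed

text \<open>Links normal forms to values of words at the free generators, so that the general laws
  of evaluation apply to \<open>reduce\<close>.\<close>

lemma word_eval_free_group: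
  assumes "fst ` set w \<subseteq> {..<k}"
  shows "word_eval (free_group k) (\<lambda>i. [(i, True)]) w = reduce w"
  using assms
proof (induction w)
  case (Cons a w)
  have "letter_eval (free_group k) (\<lambda>i. [(i, True)]) a = [a]"
    using Cons.prems inv_free_group[of "[(fst a, True)]" k]
    by (cases a) (auto simp: letter_eval_def inv_letter_def carrier_free_group)
  with Cons show ?case
    by (simp add: mult_free_group reduce_append[OF reduced_reduce, of "[a]" w, simplified])
      (simp add: reduce_def)
qed (simp add: one_free_group reduce_def)

lemma (in group) word_eval_in_hom:
  assumes "g \<in> {..<k} \<rightarrow> carrier G"
  shows "word_eval G g \<in> hom (free_group k) G"
proof (rule homI)
  fix u v assume uv: "u \<in> carrier (free_group k)" "v \<in> carrier (free_group k)"
  then show "word_eval G g (u \<otimes>\<^bsub>free_group k\<^esub> v) = word_eval G g u \<otimes> word_eval G g v"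
    using assms by (simp add: mult_free_group carrier_free_group
        word_eval_reduce[of g "{..<k}"] word_eval_append[of g "{..<k}"] image_Un)
qed (use assms in \<open>auto simp: carrier_free_group intro!: word_eval_closed[of g "{..<k}"]\<close>)

text \<open>Evaluation at \<open>g\<close> is a homomorphism from the free group, so it commutes
  with substituting words for letters.\<close>

lemma (in group) word_eval_subst:
  assumes "g \<in> {..<k} \<rightarrow> carrier G" "y \<in> I \<rightarrow> carrier (free_group k)" "fst ` set w \<subseteq> I"
  shows "word_eval G g (word_eval (free_group k) y w) = word_eval G (\<lambda>i. word_eval G g (y i)) w"
  using group.word_eval_hom[OF group_free_group is_group word_eval_in_hom[OF assms(1)] assms(2,3)]
  by simp

section \<open>Eliminating free generators by substitution\<close>

lemma reduce_append_eq: "reduce (u @ v) = foldr push u (reduce v)"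
  by (simp add: reduce_def)

text \<open>Only the leading run of inverse letters can cancel. The hypothesis makes
  \<open>q\<close> the exact length of that run, so the longer of the two powers keeps its
  surplus.\<close>

lemma foldr_push_replicate:
  assumes "v = [] \<or> hd v \<noteq> inv_letter d"
  shows "foldr push (replicate n d) (replicate q (inv_letter d) @ v) =
    (if n \<le> q then replicate (q - n) (inv_letter d) @ v else replicate (n - q) d @ v)"
proof (induction n)
  case (Suc n)
  consider "n < q" | "n = q" | "n > q" by linarith
  then show ?case
  proof cases
    case 1
    then have "q - n = Suc (q - Suc n)" by simp
    with 1 Suc show ?thesis by simp
  next
    case 2
    then show ?thesis using Suc assms by (cases v) auto
  next
    case 3
    then have "n - q = Suc (n - Suc q)" "Suc n - q = Suc (n - q)" by simp_all
    moreover have "d \<noteq> inv_letter d" using inv_letter_simps(3)[of d] by metis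
    ultimately show ?thesis using 3 Suc by simp
  qed
qed simp

lemma replicate_append_cases:
  obtains q v' where "v = replicate q x @ v'" "v' = [] \<or> hd v' \<noteq> x"
proof
  have "takeWhile (\<lambda>y. y = x) v = replicate (length (takeWhile (\<lambda>y. y = x) v)) x"
    by (rule replicate_eqI) (auto dest: set_takeWhileD)
  then show "v = replicate (length (takeWhile (\<lambda>y. y = x) v)) x @ dropWhile (\<lambda>y. y = x) v"
    by (metis takeWhile_dropWhile_id)
  show "dropWhile (\<lambda>y. y = x) v = [] \<or> hd (dropWhile (\<lambda>y. y = x) v) \<noteq> x"
    using hd_dropWhile by blast
qed

lemma replicate_append_inject:
  assumes "replicate i x @ s = replicate j x @ t"
    and "s = [] \<or> hd s \<noteq> x" "t = [] \<or> hd t \<noteq> x"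
  shows "i = j \<and> s = t"
proof -
  have *: "takeWhile (\<lambda>y. y = x) (replicate i x @ s) = replicate i x" if "s = [] \<or> hd s \<noteq> x" for i s
    using that by (induction i; cases s) auto
  have "replicate i x = replicate j x"
    using *[OF assms(2), of i] *[OF assms(3), of j] assms(1) by simp
  then have "i = j" by (metis length_replicate)
  with assms(1) show ?thesis by simp
qed

text \<open>Each pushed letter cancels one letter or is added in front. Hence \<open>a\<close>
  removes at most \<open>length a\<close> copies of \<open>e\<close> and never reaches
  \<open>t\<close>; \<open>p\<close> consists of surviving letters of \<open>a\<close>.\<close>

lemma foldr_push_replicate_append:
  assumes "length a \<le> M"
  obtains p c where "foldr push a (replicate M e @ t) = p @ replicate c e @ t"
    "length p \<le> length a" "M \<le> c + length a"
proof -
  have "\<exists>p c. foldr push a (replicate M e @ t) = p @ replicate c e @ t \<and>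
      length p \<le> length a \<and> M \<le> c + length a"
    using assms
  proof (induction a)
    case (Cons x a)
    then obtain p c where *: "foldr push a (replicate M e @ t) = p @ replicate c e @ t"
      "length p \<le> length a" "M \<le> c + length a" by auto
    show ?case
    proof (cases p)
      case Nil
      obtain c' where c': "c = Suc c'" using *(3) Cons.prems by (cases c) auto
      show ?thesis
      proof (cases "e = inv_letter x")
        case True
        then show ?thesis using * Nil c' by (intro exI[of _ "[]"] exI[of _ c']) auto
      next
        case False
        then show ?thesis using * Nil c' by (intro exI[of _ "[x]"] exI[of _ c]) auto
      qed
    next
      case (Cons y p')
      show ?thesis
      proof (cases "y = inv_letter x")
        case True
        then show ?thesis using * Cons by (intro exI[of _ p'] exI[of _ c]) auto
      next
        case False
        then show ?thesis using * Cons by (intro exI[of _ "x # p"] exI[of _ c]) auto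
      qed
    qed
  qed (intro exI[of _ "[]"] exI[of _ M], simp)
  with that show thesis by blast
qed

text \<open>\<open>foldr push u v\<close> is the product in a free group whose rank exceeds all
  indices involved, and there \<open>v\<close> can be cancelled.\<close>

lemma foldr_push_eq_self_iff:
  assumes "reduced u" "reduced v"
  shows "foldr push u v = v \<longleftrightarrow> u = []"
proof
  assume *: "foldr push u v = v"
  obtain K where K: "fst ` set (u @ v) \<subseteq> {..<K}"
    using finite_nat_set_iff_bounded[of "fst ` set (u @ v)"] by auto
  interpret F: group "free_group K" by (rule group_free_group)
  have "u \<in> carrier (free_group K)" "v \<in> carrier (free_group K)"
    using assms K by (auto simp: carrier_free_group)
  moreover have "u \<otimes>\<^bsub>free_group K\<^esub> v = v"
    using * assms by (simp add: mult_free_group reduce_append)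
  ultimately have "u = \<one>\<^bsub>free_group K\<^esub>" by simp
  then show "u = []" by (simp add: one_free_group)
qed simp

lemma length_push_ge: "length w \<le> Suc (length (push a w))"
  by (cases w) auto

lemma length_foldr_push_ge: "length v \<le> length u + length (foldr push u v)"
proof (induction u)
  case (Cons a u)
  then show ?case using length_push_ge[of "foldr push u v" a] by simp
qed simp

text \<open>Describes the gap between two blocks: half a block of sign \<open>b\<close>, the stretch
  \<open>a\<close> between them, and a block of sign \<open>c\<close> that still shows its centre. A
  letter \<open>x_0\<close> stays in front and so protects the centre of the left block.\<close>

lemma hd_foldr_push_replicate:
  assumes a: "reduced a" "length a < M" and v: "reduced (replicate M (0, c) @ (1, c) # r)"
    and ne: "a \<noteq> [] \<or> b = c"
  defines "X \<equiv> foldr push (replicate M (0, b)) (foldr push a (replicate M (0, c) @ (1, c) # r))"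
  shows "X \<noteq> [] \<and> fst (hd X) = 0"
proof -
  define d where "d = (0::nat, b)"
  define e where "e = (0::nat, c)"
  define t where "t = (1::nat, c) # r"
  let ?v = "foldr push a (replicate M e @ t)"
  obtain q v' where q: "?v = replicate q (inv_letter d) @ v'" "v' = [] \<or> hd v' \<noteq> inv_letter d"
    by (rule replicate_append_cases)
  have X: "X = (if M \<le> q then replicate (q - M) (inv_letter d) @ v' else replicate (M - q) d @ v')"
    unfolding X_def using foldr_push_replicate[OF q(2), of M q] q(1) by (simp add: d_def e_def t_def)
  \<comment> \<open>The \<open>x_0\<close>-letters in front disappear only if the two powers cancel
    exactly. Comparing the two forms of \<open>?v\<close> then shows that \<open>a\<close> is empty
    and that \<open>b\<close> and \<open>c\<close> differ, which \<open>ne\<close> excludes.\<close>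
  have "q \<noteq> M"
  proof
    assume "q = M"
    obtain p n where p: "?v = p @ replicate n e @ t" "length p \<le> length a" "M \<le> n + length a"
      using foldr_push_replicate_append[of a M e t] a by auto
    let ?x = "inv_letter d"
    \<comment> \<open>Since \<open>p\<close> is shorter than \<open>M\<close>, it lies within the
      run of inverse letters.\<close>
    have eq: "p @ replicate n e @ t = replicate (length p) ?x @ replicate (M - length p) ?x @ v'"
      using p q \<open>q = M\<close> a by (simp flip: append_assoc replicate_add)
    then have p_eq: "p = replicate (length p) ?x" and
      eq2: "replicate n e @ t = replicate (M - length p) ?x @ v'"
      by (simp_all add: append_eq_append_conv)
    obtain n' m' where "n = Suc n'" "M - length p = Suc m'"
      using p a by (cases n; cases "M - length p") auto
    with eq2 have e: "e = ?x" by simp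
    have "hd t \<noteq> ?x" by (simp add: t_def d_def inv_letter_def)
    then have "n = M - length p" "t = v'"
      using replicate_append_inject[of n ?x t "M - length p" v'] eq2 e q(2) by auto
    then have "?v = replicate M e @ t"
      using q \<open>q = M\<close> e by simp
    then have "a = []"
      using foldr_push_eq_self_iff[OF a(1), of "replicate M e @ t"] v by (simp add: e_def t_def)
    moreover have "b \<noteq> c" using e by (auto simp: e_def d_def inv_letter_def)
    ultimately show False using ne by simp
  qed
  then consider "q < M" | "q > M" by linarith
  then show ?thesis
  proof cases
    case 1
    then show ?thesis by (cases "M - q") (auto simp: X d_def)
  next
    case 2
    then show ?thesis by (cases "q - M") (auto simp: X d_def inv_letter_def)
  qed
qed

text \<open>The last generator becomes \<open>x\<^sub>0\<^sup>M x\<^sub>1 x\<^sub>0\<^sup>M\<close>. If \<open>M\<close> exceeds the length of the word,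
  the neighbouring letters cannot cancel enough to reach the central letter \<open>x\<^sub>1\<close>.\<close>

definition expand_letter :: "nat \<Rightarrow> nat \<Rightarrow> letter \<Rightarrow> letter list" where
  "expand_letter k M a =
    (if fst a = k then replicate M (0, snd a) @ (1, snd a) # replicate M (0, snd a) else [a])"

lemma concat_map_expand_letter:
  "k \<notin> fst ` set w \<Longrightarrow> concat (map (expand_letter k M) w) = w"
  by (induction w) (auto simp: expand_letter_def)

lemma split_at_letter:
  obtains a w' where "w = a @ w'" "k \<notin> fst ` set a" "w' = [] \<or> (\<exists>b u. w' = (k, b) # u)"
proof
  let ?P = "\<lambda>x. fst x \<noteq> k"
  show "w = takeWhile ?P w @ dropWhile ?P w" by simp
  show "k \<notin> fst ` set (takeWhile ?P w)" by (auto dest: set_takeWhileD)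
  show "dropWhile ?P w = [] \<or> (\<exists>b u. dropWhile ?P w = (k, b) # u)"
  proof (cases "dropWhile ?P w")
    case (Cons x u)
    then have "fst x = k" using hd_dropWhile[of ?P w] by simp
    with Cons show ?thesis by (cases x) auto
  qed simp
qed

text \<open>The induction jumps from one occurrence of \<open>x_k\<close> to the next: the suffix
  from there on is shorter and keeps its first half-block and centre, and
  \<open>hd_foldr_push_replicate\<close> stops cancellation before the current centre.\<close>

lemma reduce_expand_letter:
  assumes "reduced ((k, b) # w)" "length w < M" "2 \<le> k"
  shows "\<exists>r. reduce (concat (map (expand_letter k M) ((k, b) # w))) = replicate M (0, b) @ (1, b) # r"
  using assms(1,2)
proof (induction w arbitrary: b rule: length_induct)
  case (1 w)
  let ?E = "\<lambda>w. reduce (concat (map (expand_letter k M) w))"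
  let ?X = "foldr push (replicate M (0, b)) (?E w)"
  have X: "?X \<noteq> [] \<and> fst (hd ?X) = 0"
  proof -
    obtain a w' where w: "w = a @ w'" "k \<notin> fst ` set a" "w' = [] \<or> (\<exists>b u. w' = (k, b) # u)"
      by (rule split_at_letter)
    have red: "reduced a" using "1.prems" w(1) by (auto simp: reduced_append reduced_Cons)
    have E: "?E w = foldr push a (?E w')"
      using w by (simp add: concat_map_expand_letter reduce_append_eq)
    show ?thesis
    proof (cases "w' = []")
      case True
      then have "?E w = a" using red w by (simp add: concat_map_expand_letter reduce_eq_self)
      obtain q v' where q: "a = replicate q (inv_letter (0, b)) @ v'"
          "v' = [] \<or> hd v' \<noteq> inv_letter (0, b)"
        by (rule replicate_append_cases)
      \<comment> \<open>Without a later block, fewer than \<open>M\<close> letters are available to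
        cancel the power of \<open>x_0\<close>.\<close>
      have "length a = q + length v'" using arg_cong[OF q(1), of length] by simp
      then have "q < M" using "1.prems"(2) w(1) by simp
      then have "?X = replicate (M - q) (0, b) @ v'"
        using foldr_push_replicate[OF q(2), of M q] q(1) \<open>?E w = a\<close> by simp
      then show ?thesis using \<open>q < M\<close> by (cases "M - q") auto
    next
      case False
      then obtain c u where w': "w' = (k, c) # u" using w by auto
      have "reduced w'" using "1.prems" w(1) by (auto simp: reduced_append reduced_Cons)
      then obtain r where r: "?E w' = replicate M (0, c) @ (1, c) # r"
        using "1.IH"[rule_format, of u c] w w' "1.prems" by auto
      have "reduced (?E w')" by (rule reduced_reduce)
      \<comment> \<open>Adjacent occurrences of \<open>x_k\<close> in a reduced word have equal
        signs.\<close>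
      moreover have "a \<noteq> [] \<or> b = c"
        using "1.prems"(1) w(1) w' by (auto simp: inv_letter_def reduced_Cons)
      ultimately show ?thesis
        using hd_foldr_push_replicate[of a M c r b] red "1.prems"(2) w(1) r E by simp
    qed
  qed
  then obtain x X' where X': "?X = x # X'" "fst x = 0" by (cases ?X) auto
  then have "push (1, b) ?X = (1, b) # ?X" by (auto simp: inv_letter_def)
  moreover have "?E ((k, b) # w) = foldr push (replicate M (0, b)) (push (1, b) ?X)"
    by (simp add: reduce_append_eq expand_letter_def) (simp add: reduce_def)
  ultimately show ?case
    using foldr_push_replicate[of "(1, b) # ?X" "(0, b)" M 0]
    by (auto simp: inv_letter_def)
qed

text \<open>The part from the first block on keeps more than \<open>M\<close> letters, and the
  prefix before it, shorter than \<open>M\<close>, cancels at most its own length.\<close>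

lemma expand_letter_neq_Nil:
  assumes "reduced w" "w \<noteq> []" "length w < M" "2 \<le> k"
  shows "reduce (concat (map (expand_letter k M) w)) \<noteq> []"
proof -
  let ?E = "\<lambda>w. reduce (concat (map (expand_letter k M) w))"
  obtain a w' where w: "w = a @ w'" "k \<notin> fst ` set a" "w' = [] \<or> (\<exists>b u. w' = (k, b) # u)"
    by (rule split_at_letter)
  show ?thesis
  proof (cases "w' = []")
    case True
    then show ?thesis using w assms by (simp add: concat_map_expand_letter reduce_eq_self)
  next
    case False
    then obtain b u where w': "w' = (k, b) # u" using w by auto
    have "reduced w'" using assms w(1) by (auto simp: reduced_append)
    then obtain r where r: "?E w' = replicate M (0, b) @ (1, b) # r"
      using reduce_expand_letter[of k b u M] w w' assms by auto
    have "?E w = foldr push a (?E w')"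
      using w by (simp add: concat_map_expand_letter reduce_append_eq)
    then show ?thesis
      using length_foldr_push_ge[of "?E w'" a] r w assms by auto
  qed
qed

lemma ex_substitution_Suc:
  assumes w: "w \<in> carrier (free_group (Suc k))" "w \<noteq> []" and k: "2 \<le> k"
  obtains y where "y \<in> {..<Suc k} \<rightarrow> carrier (free_group k)" "\<And>i. i < k \<Longrightarrow> y i = [(i, True)]"
    "word_eval (free_group k) y w \<noteq> []"
proof
  define M where "M = Suc (length w)"
  define y where "y = (\<lambda>i. expand_letter k M (i, True))"
  have red: "reduced (replicate n a)" for n a
    unfolding reduced_def successively_conv_nth by (simp add: inv_letter_def prod_eq_iff)
  have exp_red: "reduced (expand_letter k M a)" for a
    by (auto simp: expand_letter_def reduced_append reduced_Cons red inv_letter_def last_replicate hd_replicate)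
  have exp_set: "fst ` set (expand_letter k M a) \<subseteq> {..<k}" if "fst a < Suc k" for a
    using that k by (auto simp: expand_letter_def)
  show y: "y \<in> {..<Suc k} \<rightarrow> carrier (free_group k)"
    using exp_red exp_set by (auto simp: y_def carrier_free_group)
  show "y i = [(i, True)]" if "i < k" for i
    using that by (simp add: y_def expand_letter_def)
  \<comment> \<open>The block is a palindrome, so inverting it only flips the signs. Evaluation at
    \<open>y\<close> is therefore letterwise replacement followed by reduction.\<close>
  have inv_exp: "inv_word (expand_letter k M a) = expand_letter k M (inv_letter a)" for a
    by (auto simp: expand_letter_def inv_letter_def inv_word_def)
  have "word_eval (free_group k) y u = reduce (concat (map (expand_letter k M) u))"
    if "fst ` set u \<subseteq> {..<Suc k}" for u
    using that
  proof (induction u)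
    case (Cons a u)
    have "letter_eval (free_group k) y a = expand_letter k M a"
      using Cons.prems y inv_exp[of "(fst a, True)"]
      by (cases a) (auto simp: letter_eval_def Pi_iff inv_free_group y_def inv_letter_def)
    with Cons show ?case
      by (simp add: mult_free_group reduce_append_eq reduce_eq_self reduced_reduce)
  qed (simp add: one_free_group reduce_def)
  then have "word_eval (free_group k) y w = reduce (concat (map (expand_letter k M) w))"
    using w by (simp add: carrier_free_group)
  then show "word_eval (free_group k) y w \<noteq> []"
    using expand_letter_neq_Nil[of w M k] w k by (simp add: carrier_free_group M_def)
qed

text \<open>Surplus generators are removed one at a time, the last first, and the substitutions are
  composed. As the first \<open>k\<close> generators stay fixed, a generating \<open>k\<close>-tuple
  keeps its members and only the added letters are replaced.\<close>

lemma ex_substitution: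
  assumes w: "w \<in> carrier (free_group (k + r))" "w \<noteq> []" and k: "2 \<le> k"
  obtains y where "y \<in> {..<k + r} \<rightarrow> carrier (free_group k)" "\<And>i. i < k \<Longrightarrow> y i = [(i, True)]"
    "word_eval (free_group k) y w \<in> carrier (free_group k)" "word_eval (free_group k) y w \<noteq> []"
proof -
  have "\<exists>y. y \<in> {..<k + r} \<rightarrow> carrier (free_group k) \<and> (\<forall>i<k. y i = [(i, True)]) \<and>
      word_eval (free_group k) y w \<noteq> []"
    using w
  proof (induction r arbitrary: w)
    case 0
    then show ?case
      by (intro exI[of _ "\<lambda>i. [(i, True)]"])
        (auto simp: carrier_free_group word_eval_free_group reduce_eq_self)
  next
    case (Suc r)
    let ?K = "k + r"
    interpret K: group "free_group ?K" by (rule group_free_group)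
    interpret F: group "free_group k" by (rule group_free_group)
    obtain y where y: "y \<in> {..<Suc ?K} \<rightarrow> carrier (free_group ?K)"
      "\<And>i. i < ?K \<Longrightarrow> y i = [(i, True)]" "word_eval (free_group ?K) y w \<noteq> []"
      using ex_substitution_Suc[of w ?K] Suc.prems k by auto
    have "word_eval (free_group ?K) y w \<in> carrier (free_group ?K)"
      using y Suc.prems by (intro K.word_eval_closed[of y "{..<Suc ?K}"]) (auto simp: carrier_free_group)
    from Suc.IH[OF this y(3)] obtain z where z: "z \<in> {..<?K} \<rightarrow> carrier (free_group k)"
      "\<forall>i<k. z i = [(i, True)]" "word_eval (free_group k) z (word_eval (free_group ?K) y w) \<noteq> []"
      by auto
    let ?x = "\<lambda>i. word_eval (free_group k) z (y i)"
    have "?x \<in> {..<k + Suc r} \<rightarrow> carrier (free_group k)"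
    proof
      fix i assume "i \<in> {..<k + Suc r}"
      then have "y i \<in> carrier (free_group ?K)" using y(1) by auto
      then show "?x i \<in> carrier (free_group k)"
        using z(1) by (intro F.word_eval_closed[of z "{..<?K}"]) (auto simp: carrier_free_group)
    qed
    moreover have "?x i = [(i, True)]" if "i < k" for i
      using that y(2)[of i] z by (simp add: letter_eval_def mult_free_group one_free_group reduce_eq_self)
    moreover have "word_eval (free_group k) ?x w \<noteq> []"
      using F.word_eval_subst[OF z(1) y(1)] z(3) Suc.prems by (auto simp: carrier_free_group)
    ultimately show ?case by blast
  qed
  then obtain y where y: "y \<in> {..<k + r} \<rightarrow> carrier (free_group k)" "\<And>i. i < k \<Longrightarrow> y i = [(i, True)]"
    "word_eval (free_group k) y w \<noteq> []" by auto
  moreover have "word_eval (free_group k) y w \<in> carrier (free_group k)"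
    using y w group.word_eval_closed[OF group_free_group, of y "{..<k + r}" k w]
    by (simp add: carrier_free_group)
  ultimately show thesis using that by blast
qed

section \<open>Preforming a free group\<close>

lemma not_almost_identityD:
  assumes "\<not> (\<exists>w. is_almost_identity H k w)" "w \<in> carrier (free_group k)" "w \<noteq> []"
  obtains h where "generating_set H (h ` {..<k})" "word_eval H h w \<noteq> \<one>\<^bsub>H\<^esub>"
  using assms unfolding is_almost_identity_def one_free_group by auto

text \<open>The word \<open>[u, t v t\<^sup>-\<^sup>1]\<close> with a fresh letter \<open>t\<close> is reduced as it stands; \<open>t\<close> is then
  eliminated by substitution.\<close>

lemma ex_word_avoiding:
  assumes k: "2 \<le> k" and U: "finite U" "U \<subseteq> carrier (free_group k)" "[] \<notin> U"
  shows "\<exists>c. c \<in> carrier (free_group k) \<and> c \<noteq> [] \<and>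
    (\<forall>(G :: ('a, 'c) monoid_scheme) g. group G \<longrightarrow> g \<in> {..<k} \<rightarrow> carrier G \<longrightarrow>
      word_eval G g c \<noteq> \<one>\<^bsub>G\<^esub> \<longrightarrow> (\<forall>u\<in>U. word_eval G g u \<noteq> \<one>\<^bsub>G\<^esub>))"
  using U
proof (induction U rule: finite_induct)
  case empty
  then show ?case using k by (intro exI[of _ "[(0, True)]"]) (auto simp: carrier_free_group)
next
  case (insert u U)
  then obtain v where v: "v \<in> carrier (free_group k)" "v \<noteq> []"
    "\<And>(G :: ('a, 'c) monoid_scheme) g u. group G \<Longrightarrow> g \<in> {..<k} \<rightarrow> carrier G \<Longrightarrow>
      word_eval G g v \<noteq> \<one>\<^bsub>G\<^esub> \<Longrightarrow> u \<in> U \<Longrightarrow> word_eval G g u \<noteq> \<one>\<^bsub>G\<^esub>" by auto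
  have u: "u \<in> carrier (free_group k)" "u \<noteq> []" using insert.prems by auto
  define z where "z = u @ (k, True) # v @ (k, False) # inv_word u @ (k, True) # inv_word v @ [(k, False)]"
  \<comment> \<open>Letters of \<open>u\<close> and \<open>v\<close> have indices below
    \<open>k\<close>, so they cannot cancel against the fresh letter \<open>x_k\<close>.\<close>
  have fresh: "hd w \<noteq> (k, b)" "hd w \<noteq> inv_letter (k, b)" "last w \<noteq> (k, b)" "last w \<noteq> inv_letter (k, b)"
      "hd (inv_word w) \<noteq> (k, b)" "hd (inv_word w) \<noteq> inv_letter (k, b)"
      "(k, b) \<noteq> inv_letter (last w)" "(k, b) \<noteq> inv_letter (last (inv_word w))"
    if w: "w \<in> carrier (free_group k)" "w \<noteq> []" for w b
  proof -
    have *: "fst (hd w') < k \<and> fst (last w') < k" if "w' \<in> {w, inv_word w}" for w'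
    proof -
      have "w' \<noteq> []" using that w by (auto simp: inv_word_def)
      moreover have "fst ` set w' \<subseteq> {..<k}"
        using that w fst_set_inv_word[of w] by (auto simp: carrier_free_group simp del: fst_set_inv_word)
      moreover have "hd w' \<in> set w'" "last w' \<in> set w'" using calculation(1) by simp_all
      ultimately show ?thesis by blast
    qed
    from *[of w] *[of "inv_word w"]
    show "hd w \<noteq> (k, b)" "hd w \<noteq> inv_letter (k, b)" "last w \<noteq> (k, b)" "last w \<noteq> inv_letter (k, b)"
      "hd (inv_word w) \<noteq> (k, b)" "hd (inv_word w) \<noteq> inv_letter (k, b)"
      "(k, b) \<noteq> inv_letter (last w)" "(k, b) \<noteq> inv_letter (last (inv_word w))"
      by (auto simp: inv_letter_def)
  qed
  have "reduced z"
    using u v(1,2) fresh[OF u] fresh[OF v(1,2)]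
    by (simp add: z_def reduced_append reduced_Cons carrier_free_group)
  moreover have "fst ` set z \<subseteq> {..<k + 1}"
    using u v by (auto simp: z_def carrier_free_group image_Un)
  ultimately have z: "z \<in> carrier (free_group (k + 1))" "z \<noteq> []"
    by (auto simp: carrier_free_group z_def)
  from ex_substitution[OF z k] obtain y where y: "y \<in> {..<k + 1} \<rightarrow> carrier (free_group k)"
    "\<And>i. i < k \<Longrightarrow> y i = [(i, True)]" "word_eval (free_group k) y z \<in> carrier (free_group k)"
    "word_eval (free_group k) y z \<noteq> []" by blast
  have "word_eval G g u' \<noteq> \<one>\<^bsub>G\<^esub>"
    if G: "group G" and g: "g \<in> {..<k} \<rightarrow> carrier G"
      and ne: "word_eval G g (word_eval (free_group k) y z) \<noteq> \<one>\<^bsub>G\<^esub>" and u': "u' \<in> insert u U"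
    for G :: "('a, 'c) monoid_scheme" and g u'
  proof -
    interpret group G by fact
    \<comment> \<open>\<open>h\<close> extends \<open>g\<close> by the value substituted for the
      fresh letter, so the new word at \<open>g\<close> equals \<open>z\<close> at
      \<open>h\<close>.\<close>
    define h where "h = (\<lambda>i. word_eval G g (y i))"
    have h: "h \<in> {..<k + 1} \<rightarrow> carrier G"
      using y(1) g by (auto simp: h_def carrier_free_group Pi_iff intro!: word_eval_closed[of g "{..<k}"])
    have h_eq: "h i = g i" if "i < k" for i
      using that y(2) g by (auto simp: h_def letter_eval_def Pi_iff)
    have h_word: "word_eval G h w = word_eval G g w" if "w \<in> carrier (free_group k)" for w
      using that h_eq by (intro word_eval_cong) (auto simp: carrier_free_group)
    have ne: "word_eval G h z \<noteq> \<one>\<^bsub>G\<^esub>"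
      using ne word_eval_subst[OF g y(1), of z] z by (simp add: h_def carrier_free_group)
    have uv: "fst ` set u \<subseteq> {..<k + 1}" "fst ` set v \<subseteq> {..<k + 1}"
      using u v by (auto simp: carrier_free_group)
    let ?u = "word_eval G h u" and ?v = "word_eval G h v" and ?t = "h k"
    have t: "?t \<in> carrier G" "?u \<in> carrier G" "?v \<in> carrier G"
      using h uv by (auto simp: word_eval_closed[OF h])
    have "word_eval G h z = ?u \<otimes>\<^bsub>G\<^esub> (?t \<otimes>\<^bsub>G\<^esub> (?v \<otimes>\<^bsub>G\<^esub> (inv\<^bsub>G\<^esub> ?t \<otimes>\<^bsub>G\<^esub> (inv\<^bsub>G\<^esub> ?u \<otimes>\<^bsub>G\<^esub> (?t \<otimes>\<^bsub>G\<^esub> (inv\<^bsub>G\<^esub> ?v \<otimes>\<^bsub>G\<^esub> inv\<^bsub>G\<^esub> ?t))))))"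
      using uv t unfolding z_def
      by (simp add: word_eval_append[OF h] word_eval_inv_word[OF h] letter_eval_def image_Un)
    moreover have "inv\<^bsub>G\<^esub> a \<otimes>\<^bsub>G\<^esub> (a \<otimes>\<^bsub>G\<^esub> b) = b" "a \<otimes>\<^bsub>G\<^esub> (inv\<^bsub>G\<^esub> a \<otimes>\<^bsub>G\<^esub> b) = b"
      if "a \<in> carrier G" "b \<in> carrier G" for a b
      using that by (simp_all add: m_assoc[symmetric])
    \<comment> \<open>A commutator with a trivial entry is trivial, and so is any conjugate of a
      trivial element.\<close>
    ultimately have "?u \<noteq> \<one>\<^bsub>G\<^esub> \<and> ?v \<noteq> \<one>\<^bsub>G\<^esub>"
      using ne t by auto
    then have "word_eval G g u \<noteq> \<one>\<^bsub>G\<^esub> \<and> word_eval G g v \<noteq> \<one>\<^bsub>G\<^esub>"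
      using h_word u v by simp
    with v(3)[OF G g] u' show ?thesis by auto
  qed
  with y show ?case by blast
qed

section \<open>Balls in Cayley graphs and short words\<close>

text \<open>Crossing an edge forwards multiplies on the right by a generator, backwards by its
  inverse, so a path from the root reads off a word, not necessarily a reduced one.\<close>

lemma ball_verts_cayley_graph:
  fixes G (structure)
  assumes G: "group G" and g: "g \<in> I \<rightarrow> carrier G"
  shows "ball_verts (cayley_graph G (g ` I)) R =
    {word_eval G g w | w. fst ` set w \<subseteq> I \<and> length w \<le> R}"
proof -
  interpret group G by fact
  let ?X = "cayley_graph G (g ` I)"
  have path: "(\<one>, v) \<in> adjacent ?X ^^ n \<longleftrightarrow>
      (\<exists>w. v = word_eval G g w \<and> fst ` set w \<subseteq> I \<and> length w = n)" for v n
  proof (induction n arbitrary: v)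
    case (Suc n)
    have edge: "(u, v) \<in> adjacent ?X \<longleftrightarrow> (\<exists>a. fst a \<in> I \<and> v = u \<otimes> letter_eval G g a)"
      if u: "u \<in> carrier G" for u
    proof
      assume "(u, v) \<in> adjacent ?X"
      then obtain i where i: "i \<in> I" "v = u \<otimes> g i \<or> v \<in> carrier G \<and> u = v \<otimes> g i"
        by (auto simp: adjacent_def cayley_graph_def)
      with g u have "v = u \<otimes> letter_eval G g (i, True) \<or> v = u \<otimes> letter_eval G g (i, False)"
        by (auto simp: letter_eval_def Pi_iff m_assoc)
      with i show "\<exists>a. fst a \<in> I \<and> v = u \<otimes> letter_eval G g a" by (metis fst_conv)
    next
      assume "\<exists>a. fst a \<in> I \<and> v = u \<otimes> letter_eval G g a"
      then obtain i b where "i \<in> I" "v = u \<otimes> letter_eval G g (i, b)" by auto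
      then show "(u, v) \<in> adjacent ?X"
        using g u by (cases b) (auto simp: adjacent_def cayley_graph_def letter_eval_def Pi_iff m_assoc
            intro!: exI[of _ "g i"])
    qed
    have "(\<one>, v) \<in> adjacent ?X ^^ Suc n \<longleftrightarrow>
        (\<exists>w a. fst ` set w \<subseteq> I \<and> length w = n \<and> fst a \<in> I \<and> v = word_eval G g w \<otimes> letter_eval G g a)"
      (is "_ \<longleftrightarrow> ?R")
    proof
      assume "(\<one>, v) \<in> adjacent ?X ^^ Suc n"
      then obtain u where "(\<one>, u) \<in> adjacent ?X ^^ n" "(u, v) \<in> adjacent ?X" by auto
      then show ?R using Suc.IH[of u] edge[of u] word_eval_closed[OF g] by auto
    next
      assume ?R
      then obtain w a where w: "fst ` set w \<subseteq> I" "length w = n" "fst a \<in> I"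
        "v = word_eval G g w \<otimes> letter_eval G g a" by auto
      then have "(\<one>, word_eval G g w) \<in> adjacent ?X ^^ n" using Suc.IH by blast
      moreover have "(word_eval G g w, v) \<in> adjacent ?X"
        using edge[of "word_eval G g w"] word_eval_closed[OF g, of w] w by blast
      ultimately show "(\<one>, v) \<in> adjacent ?X ^^ Suc n" by auto
    qed
    also have "\<dots> \<longleftrightarrow> (\<exists>w. v = word_eval G g w \<and> fst ` set w \<subseteq> I \<and> length w = Suc n)" (is "_ \<longleftrightarrow> ?S")
    proof
      assume ?R
      then obtain w a where "fst ` set w \<subseteq> I" "length w = n" "fst a \<in> I"
        "v = word_eval G g w \<otimes> letter_eval G g a" by auto
      then show ?S
        using word_eval_append[OF g, of w "[a]"] letter_eval_closed[OF g]
        by (intro exI[of _ "w @ [a]"]) auto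
    next
      assume ?S
      then obtain w where w: "v = word_eval G g w" "fst ` set w \<subseteq> I" "length w = Suc n" by auto
      then obtain u a where "w = u @ [a]" by (cases w rule: rev_cases) auto
      with w show ?R
        using word_eval_append[OF g, of u "[a]"] letter_eval_closed[OF g]
        by (intro exI[of _ u] exI[of _ a]) auto
    qed
    finally show ?case .
  qed auto
  show ?thesis
    using word_eval_closed[OF g] path
    by (auto simp: ball_verts_def cayley_graph_def[of G "g ` I"] path[unfolded cayley_graph_def])
qed

text \<open>An isomorphism of balls takes the end point of a path to the end point of the path with the
  same labels.\<close>

lemma rooted_graph_iso_word_eval:
  assumes G: "group G" and H: "group H" and s: "s \<in> I \<rightarrow> carrier G" and t: "t \<in> I \<rightarrow> carrier H"
    and \<beta>: "\<And>i. i \<in> I \<Longrightarrow> \<beta> (s i) = t i"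
    and iso: "rooted_graph_iso \<beta> (graph_ball (cayley_graph G (s ` I)) R) (graph_ball (cayley_graph H (t ` I)) R)"
    and u: "fst ` set u \<subseteq> I" "length u \<le> R" and v: "fst ` set v \<subseteq> I" "length v \<le> R"
  shows "word_eval G s u = word_eval G s v \<longleftrightarrow> word_eval H t u = word_eval H t v"
proof -
  interpret G: group G by fact
  interpret H: group H by fact
  let ?X = "graph_ball (cayley_graph G (s ` I)) R" and ?Y = "graph_ball (cayley_graph H (t ` I)) R"
  obtain \<phi> where \<phi>: "bij_betw \<phi> (g_verts ?X) (g_verts ?Y)" "\<phi> (g_root ?X) = g_root ?Y"
    "g_edges ?Y = (\<lambda>(u, s, v). (\<phi> u, \<beta> s, \<phi> v)) ` g_edges ?X"
    using iso by (auto simp: rooted_graph_iso_def)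
  have vert: "word_eval G s w \<in> g_verts ?X" if "fst ` set w \<subseteq> I" "length w \<le> R" for w
    using that by (auto simp: graph_ball_def ball_verts_cayley_graph[OF G s])
  \<comment> \<open>The image of an edge is an edge with the matching label, and in a Cayley graph
    start and label determine the end point.\<close>
  have edge: "\<phi> b = \<phi> a \<otimes>\<^bsub>H\<^esub> t i \<and> \<phi> a \<in> carrier H"
    if "a \<in> g_verts ?X" "b \<in> g_verts ?X" "b = a \<otimes>\<^bsub>G\<^esub> s i" "i \<in> I" for a b i
  proof -
    have "(a, s i, b) \<in> g_edges ?X"
      using that by (auto simp: graph_ball_def cayley_graph_def ball_verts_def)
    then have "(\<phi> a, t i, \<phi> b) \<in> g_edges ?Y"
      using \<beta>[OF that(4)] by (auto simp: \<phi>(3) intro!: rev_image_eqI)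
    then show ?thesis
      by (auto simp: graph_ball_def cayley_graph_def)
  qed
  have \<phi>_word: "\<phi> (word_eval G s w) = word_eval H t w" if "fst ` set w \<subseteq> I" "length w \<le> R" for w
    using that
  proof (induction w rule: rev_induct)
    case Nil
    then show ?case using \<phi>(2) by (simp add: graph_ball_def cayley_graph_def)
  next
    case (snoc a w)
    obtain i b where a: "a = (i, b)" by (cases a)
    have i: "i \<in> I" and w: "fst ` set w \<subseteq> I" "length w \<le> R" using snoc.prems a by auto
    have IH: "\<phi> (word_eval G s w) = word_eval H t w" using snoc.IH w by simp
    have si: "s i \<in> carrier G" "t i \<in> carrier H" using i s t by auto
    have wc: "word_eval G s w \<in> carrier G" "word_eval H t w \<in> carrier H"
      using w G.word_eval_closed[OF s] H.word_eval_closed[OF t] by auto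
    have G_eq: "word_eval G s (w @ [a]) = word_eval G s w \<otimes>\<^bsub>G\<^esub> letter_eval G s a"
      using G.word_eval_append[OF s w(1), of "[a]"] i a G.letter_eval_closed[OF s, of a] by simp
    have H_eq: "word_eval H t (w @ [a]) = word_eval H t w \<otimes>\<^bsub>H\<^esub> letter_eval H t a"
      using H.word_eval_append[OF t w(1), of "[a]"] i a H.letter_eval_closed[OF t, of a] by simp
    have V: "word_eval G s w \<in> g_verts ?X" "word_eval G s (w @ [a]) \<in> g_verts ?X"
      using vert[OF w] vert[OF snoc.prems] by auto
    show ?case
    proof (cases b)
      case True
      then show ?thesis
        using edge[OF V _ i] G_eq H_eq IH a by (simp add: letter_eval_def)
    next
      case False
      \<comment> \<open>An inverse letter is an edge run backwards, from the new vertex to the old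
        one.\<close>
      then have "word_eval G s w = word_eval G s (w @ [a]) \<otimes>\<^bsub>G\<^esub> s i"
        using G_eq a wc si by (simp add: letter_eval_def G.m_assoc)
      from edge[OF V(2) V(1) this i]
      have "word_eval H t w = \<phi> (word_eval G s (w @ [a])) \<otimes>\<^bsub>H\<^esub> t i"
        "\<phi> (word_eval G s (w @ [a])) \<in> carrier H" using IH by auto
      then show ?thesis
        using H_eq a False si by (simp add: letter_eval_def H.m_assoc)
    qed
  qed
  have "inj_on \<phi> (g_verts ?X)" using \<phi>(1) by (rule bij_betw_imp_inj_on)
  then have "\<phi> (word_eval G s u) = \<phi> (word_eval G s v) \<longleftrightarrow> word_eval G s u = word_eval G s v"
    using vert u v by (intro inj_on_eq_iff)
  then show ?thesis using \<phi>_word u v by simp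
qed

text \<open>\<open>T\<close> may differ from the standard basis, so the basis is expressed by words
  \<open>p i\<close> in \<open>T\<close>. Their values \<open>h\<close> in \<open>W\<close> form a
  \<open>k\<close>-tuple; if the balls are large, it generates \<open>W\<close>, and
  \<open>w\<close> vanishing at \<open>h\<close> would give a relation among free
  generators.\<close>

lemma preforms_free_group_imp_not_almost_identity:
  assumes W: "group W" and pre: "preforms W (free_group k)"
  shows "\<not> is_almost_identity W k w"
proof
  assume "is_almost_identity W k w"
  then have w: "w \<in> carrier (free_group k)" "w \<noteq> []"
    and ai: "\<And>h. generating_set W (h ` {..<k}) \<Longrightarrow> word_eval W h w = \<one>\<^bsub>W\<^esub>"
    by (auto simp: is_almost_identity_def one_free_group)
  interpret W: group W by fact
  interpret F: group "free_group k" by (rule group_free_group)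
  let ?F = "free_group k" and ?x = "\<lambda>i::nat. [(i, True)]"
  obtain T S \<beta> where T: "finite T" "generating_set ?F T"
    and S: "\<And>n::nat. finite (S n) \<and> generating_set W (S n) \<and> bij_betw (\<beta> n) (S n) T"
    and iso: "\<And>R::nat. \<exists>n0. \<forall>n\<ge>n0.
        rooted_graph_iso (\<beta> n) (graph_ball (cayley_graph W (S n)) R) (graph_ball (cayley_graph ?F T) R)"
    using pre unfolding preforms_def by blast
  obtain t where t_bij: "bij_betw t {..<card T} T"
    using ex_bij_betw_nat_finite[OF T(1)] by (auto simp: atLeast0LessThan)
  define I where "I = {..<card T}"
  have tI: "T = t ` I" using t_bij by (simp add: bij_betw_def I_def)
  with T(2) have t: "t \<in> I \<rightarrow> carrier ?F" and t_gen: "\<And>x. x \<in> carrier ?F \<Longrightarrow> \<exists>w. fst ` set w \<subseteq> I \<and> word_eval ?F t w = x"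
    using F.generating_set_iff_word_eval[of t I] by simp_all
  have x: "?x \<in> {..<k} \<rightarrow> carrier ?F" by (auto simp: carrier_free_group)
  have "\<forall>i. \<exists>p. i < k \<longrightarrow> fst ` set p \<subseteq> I \<and> word_eval ?F t p = ?x i"
    using t_gen x by (auto simp: Pi_iff)
  then obtain p where p: "\<And>i. i < k \<Longrightarrow> fst ` set (p i) \<subseteq> I \<and> word_eval ?F t (p i) = ?x i"
    by metis
  define subst where "subst u = concat (map (\<lambda>a. if snd a then p (fst a) else inv_word (p (fst a))) u)"
    for u :: "letter list"
  have subst_set: "fst ` set (subst u) \<subseteq> I" if "fst ` set u \<subseteq> {..<k}" for u
    using that
  proof (induction u)
    case (Cons a u)
    then have "fst ` set (p (fst a)) \<subseteq> I" using p by auto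
    with Cons show ?case by (simp add: subst_def image_Un)
  qed (simp add: subst_def)
  have subst_eval: "word_eval K g (subst u) = word_eval K (\<lambda>i. word_eval K g (p i)) u"
    if "group K" "g \<in> I \<rightarrow> carrier K" "fst ` set u \<subseteq> {..<k}" for K :: "('x, 'y) monoid_scheme" and g u
    using that(3)
  proof (induction u)
    case Nil
    then show ?case by (simp add: subst_def)
  next
    case (Cons a u)
    interpret K: group K by fact
    let ?pa = "if snd a then p (fst a) else inv_word (p (fst a))"
    have pa: "fst ` set (p (fst a)) \<subseteq> I" using p Cons.prems by auto
    have "word_eval K g (subst (a # u)) = word_eval K g (?pa @ subst u)" by (simp add: subst_def)
    also have "\<dots> = word_eval K g ?pa \<otimes>\<^bsub>K\<^esub> word_eval K g (subst u)"
      using pa Cons.prems subst_set by (intro K.word_eval_append[OF that(2)]) auto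
    finally show ?case
      using Cons K.word_eval_inv_word[OF that(2) pa] by (simp add: letter_eval_def)
  qed
  have x_subst: "word_eval ?F t (subst u) = reduce u" if u: "fst ` set u \<subseteq> {..<k}" for u
  proof -
    have "word_eval ?F t (subst u) = word_eval ?F ?x u"
      unfolding subst_eval[OF F.is_group t u] using u p by (intro word_eval_cong) auto
    then show ?thesis using word_eval_free_group[OF u] by simp
  qed
  have t_set: "reduced (t i)" "fst ` set (t i) \<subseteq> {..<k}" if "i \<in> I" for i
    using t that by (auto simp: carrier_free_group Pi_iff)
  \<comment> \<open>The radius covers all words compared below; \<open>Suc\<close> leaves room for
    the single letters \<open>[(i, True)]\<close>.\<close>
  define R where "R = Suc (Max (insert (length (subst w)) ((\<lambda>i. length (subst (t i))) ` I)))"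
  have R: "length (subst w) \<le> R" "1 \<le> R" "i \<in> I \<Longrightarrow> length (subst (t i)) \<le> R" for i
    unfolding R_def by (auto simp: I_def intro!: le_SucI Max_ge)
  obtain n where n: "rooted_graph_iso (\<beta> n) (graph_ball (cayley_graph W (S n)) R) (graph_ball (cayley_graph ?F T) R)"
    using iso by blast
  define s where "s i = inv_into (S n) (\<beta> n) (t i)" for i
  have bij: "bij_betw (\<beta> n) (S n) T" using S by blast
  have s\<beta>: "\<beta> n (s i) = t i" if "i \<in> I" for i
    using that bij tI by (auto simp: s_def bij_betw_def intro!: f_inv_into_f)
  have sI: "s ` I = S n"
  proof -
    have "s ` I = inv_into (S n) (\<beta> n) ` T" by (simp add: s_def tI image_image)
    then show ?thesis using bij by (metis bij_betw_def bij_betw_inv_into)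
  qed
  have s_gen: "generating_set W (s ` I)" using S[of n] sI by simp
  then have s: "s \<in> I \<rightarrow> carrier W" using W.generating_set_iff_word_eval[of s I] by simp
  note same = rooted_graph_iso_word_eval[OF W F.is_group s t s\<beta> n[folded sI, unfolded tI]]
  define h where "h i = word_eval W s (p i)" for i
  have h: "h \<in> {..<k} \<rightarrow> carrier W"
    using p W.word_eval_closed[OF s] by (auto simp: h_def)
  have h_word: "word_eval W s (subst u) = word_eval W h u" if "fst ` set u \<subseteq> {..<k}" for u
    using subst_eval[OF W s that] by (simp add: h_def[abs_def])
  \<comment> \<open>\<open>t i\<close> is itself a word in the basis. Rewritten in terms of
    \<open>T\<close> it has the same value as the single letter \<open>i\<close>, and the
    isomorphism of balls transfers this relation to \<open>W\<close>.\<close>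
  have "s i \<in> generate W (h ` {..<k})" if i: "i \<in> I" for i
  proof -
    have "word_eval ?F t (subst (t i)) = word_eval ?F t [(i, True)]"
      using x_subst[of "t i"] t_set[OF i] i t by (simp add: letter_eval_def reduce_eq_self Pi_iff)
    then have "word_eval W s (subst (t i)) = word_eval W s [(i, True)]"
      using same[of "subst (t i)" "[(i, True)]"] subst_set[of "t i"] t_set[OF i] R i by auto
    then have "s i = word_eval W h (t i)"
      using h_word[of "t i"] t_set[OF i] i s by (simp add: letter_eval_def Pi_iff)
    then show ?thesis
      using t_set[OF i] W.generate_eq_word_eval[OF h] by auto
  qed
  then have "generate W (s ` I) \<subseteq> generate W (h ` {..<k})"
    using h by (intro W.generate_subgroup_incl W.generate_is_subgroup) auto
  then have "generating_set W (h ` {..<k})"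
    using s_gen h W.generate_incl[of "h ` {..<k}"] by (auto simp: generating_set_def)
  from ai[OF this] have "word_eval W s (subst w) = word_eval W s []"
    using h_word w by (simp add: carrier_free_group)
  \<comment> \<open>The relation is carried back to the free group, where it makes \<open>w\<close>
    trivial.\<close>
  then have "word_eval ?F t (subst w) = word_eval ?F t []"
    using same[of "subst w" "[]"] subst_set[of w] R w by (auto simp: carrier_free_group)
  then have "reduce w = []" using x_subst[of w] w by (simp add: carrier_free_group one_free_group)
  then show False using w reduce_eq_self[of w] by (simp add: carrier_free_group)
qed

text \<open>Evaluation of words maps the ball of the free group to that of \<open>W\<close>, whereas
  \<open>preforms\<close> asks for an isomorphism in the opposite direction.\<close>

lemma rooted_graph_iso_sym:
  assumes \<psi>: "bij_betw \<psi> (g_verts Y) (g_verts X)" "\<psi> (g_root Y) = g_root X" "g_root Y \<in> g_verts Y"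
    and E: "g_edges X = (\<lambda>(u, s, v). (\<psi> u, \<alpha> s, \<psi> v)) ` g_edges Y"
    and Y: "\<And>u s v. (u, s, v) \<in> g_edges Y \<Longrightarrow> u \<in> g_verts Y \<and> v \<in> g_verts Y \<and> \<beta> (\<alpha> s) = s"
  shows "rooted_graph_iso \<beta> X Y"
  unfolding rooted_graph_iso_def
proof (intro exI conjI)
  let ?\<phi> = "inv_into (g_verts Y) \<psi>"
  have inv: "?\<phi> (\<psi> u) = u" if "u \<in> g_verts Y" for u
    using that \<psi>(1) by (simp add: bij_betw_def)
  show "bij_betw ?\<phi> (g_verts X) (g_verts Y)" using \<psi>(1) by (rule bij_betw_inv_into)
  show "?\<phi> (g_root X) = g_root Y" using \<psi> inv by metis
  have "(\<lambda>(u, s, v). (?\<phi> u, \<beta> s, ?\<phi> v)) ` g_edges X = (\<lambda>e. e) ` g_edges Y"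
    unfolding E image_image using Y inv by (intro image_cong refl) auto
  then show "g_edges Y = (\<lambda>(u, s, v). (?\<phi> u, \<beta> s, ?\<phi> v)) ` g_edges X" by simp
qed

text \<open>For each \<open>n\<close>, a single word \<open>c\<close> controls all non-trivial
  reduced words of length at most \<open>n\<close>. A generating tuple with non-trivial value of
  \<open>c\<close> satisfies no relation this short, so evaluation at it is injective on a
  ball.\<close>

lemma preforms_free_group_if_not_almost_identity:
  fixes W :: "('a, 'c) monoid_scheme"
  assumes W: "group W" and k: "2 \<le> k" and na: "\<not> (\<exists>w. is_almost_identity W k w)"
  shows "preforms W (free_group k)"
proof -
  interpret W: group W by fact
  interpret F: group "free_group k" by (rule group_free_group)
  let ?F = "free_group k" and ?x = "\<lambda>i::nat. [(i, True)]"
  have x: "?x \<in> {..<k} \<rightarrow> carrier ?F" by (auto simp: carrier_free_group)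
  have "\<exists>g. generating_set W (g ` {..<k}) \<and>
      (\<forall>u. u \<in> carrier ?F \<longrightarrow> u \<noteq> [] \<longrightarrow> length u \<le> n \<longrightarrow> word_eval W g u \<noteq> \<one>\<^bsub>W\<^esub>)" for n
  proof -
    let ?U = "{u \<in> carrier ?F. u \<noteq> [] \<and> length u \<le> n}"
    have "?U \<subseteq> {u. set u \<subseteq> {..<k} \<times> UNIV \<and> length u \<le> n}"
      by (auto simp: carrier_free_group)
    then have fin: "finite ?U"
      by (rule finite_subset) (intro finite_lists_length_le finite_cartesian_product; simp)
    obtain c where c: "c \<in> carrier ?F" "c \<noteq> []"
      "\<And>g u. g \<in> {..<k} \<rightarrow> carrier W \<Longrightarrow> word_eval W g c \<noteq> \<one>\<^bsub>W\<^esub> \<Longrightarrow> u \<in> ?U \<Longrightarrow> word_eval W g u \<noteq> \<one>\<^bsub>W\<^esub>"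
      using ex_word_avoiding[OF k fin, where 'a = 'a and 'c = 'c] W by blast
    obtain g where g: "generating_set W (g ` {..<k})" "word_eval W g c \<noteq> \<one>\<^bsub>W\<^esub>"
      using not_almost_identityD[OF na c(1,2)] by blast
    then have "g \<in> {..<k} \<rightarrow> carrier W" by (auto simp: generating_set_def)
    with c(3) g show ?thesis by blast
  qed
  then obtain g where g_gen: "\<And>n. generating_set W (g n ` {..<k})"
    and g_ne: "\<And>n u. u \<in> carrier ?F \<Longrightarrow> u \<noteq> [] \<Longrightarrow> length u \<le> n \<Longrightarrow> word_eval W (g n) u \<noteq> \<one>\<^bsub>W\<^esub>"
    by metis
  have g: "g n \<in> {..<k} \<rightarrow> carrier W" for n
    using g_gen[of n] by (auto simp: generating_set_def)
  \<comment> \<open>Quotients \<open>u v^-1\<close> turn the absence of short relations into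
    injectivity on short words.\<close>
  have g_eq: "word_eval W (g n) u = word_eval W (g n) v \<longleftrightarrow> reduce u = reduce v"
    if u: "fst ` set u \<subseteq> {..<k}" and v: "fst ` set v \<subseteq> {..<k}" and n: "length u + length v \<le> n"
    for u v n
  proof
    assume "reduce u = reduce v"
    then show "word_eval W (g n) u = word_eval W (g n) v"
      using W.word_eval_reduce[OF g u, of n] W.word_eval_reduce[OF g v, of n] by simp
  next
    assume eq: "word_eval W (g n) u = word_eval W (g n) v"
    let ?w = "reduce (u @ inv_word v)"
    have w: "fst ` set (u @ inv_word v) \<subseteq> {..<k}" using u v by (simp add: image_Un)
    have "word_eval W (g n) ?w = \<one>\<^bsub>W\<^esub>"
      using eq u v w W.word_eval_closed[OF g, of v n]
      by (simp add: W.word_eval_reduce[OF g] W.word_eval_append[OF g] W.word_eval_inv_word[OF g])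
    moreover have "?w \<in> carrier ?F"
      using w set_reduce[of "u @ inv_word v"] by (auto simp: carrier_free_group reduced_reduce)
    moreover have "length (reduce w) \<le> length w" for w
    proof (induction w)
      case (Cons a w)
      have "length (push a (reduce w)) \<le> Suc (length (reduce w))" by (cases "reduce w") auto
      with Cons show ?case by (simp add: reduce_def)
    qed (simp add: reduce_def)
    from this[of "u @ inv_word v"] have "length ?w \<le> n" using n by simp
    ultimately have "?w = []" using g_ne by blast
    then have "word_eval ?F ?x (u @ inv_word v) = \<one>\<^bsub>?F\<^esub>"
      using word_eval_free_group[OF w] by (simp add: one_free_group)
    then have "word_eval ?F ?x u \<otimes>\<^bsub>?F\<^esub> inv\<^bsub>?F\<^esub> word_eval ?F ?x v = \<one>\<^bsub>?F\<^esub>"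
      using u v by (simp add: F.word_eval_append[OF x] F.word_eval_inv_word[OF x])
    then have "word_eval ?F ?x u = word_eval ?F ?x v"
      using F.word_eval_closed[OF x u] F.word_eval_closed[OF x v]
      by (metis F.inv_closed F.inv_equality F.inv_inv)
    then show "reduce u = reduce v"
      using word_eval_free_group[OF u] word_eval_free_group[OF v] by simp
  qed
  define T where "T = ?x ` {..<k}"
  \<comment> \<open>Two single letters have total length 2, so the shift by 2 keeps the
    \<open>k\<close> generators distinct for every \<open>n\<close>; the bijections are required at
    all indices, not only at large ones.\<close>
  define S where "S n = g (n + 2) ` {..<k}" for n
  define \<alpha> where "\<alpha> n u = word_eval W (g (n + 2)) u" for n u
  define \<beta> where "\<beta> n = inv_into T (\<alpha> n)" for n
  have \<alpha>_x: "\<alpha> n (?x i) = g (n + 2) i" if "i < k" for n i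
    using that g[of "n + 2"] by (auto simp: \<alpha>_def letter_eval_def Pi_iff)
  have T_gen: "generating_set ?F T"
    unfolding T_def F.generating_set_iff_word_eval
  proof (intro conjI x ballI)
    fix w assume "w \<in> carrier ?F"
    then show "\<exists>u. fst ` set u \<subseteq> {..<k} \<and> word_eval ?F ?x u = w"
      by (intro exI[of _ w]) (simp add: word_eval_free_group carrier_free_group reduce_eq_self)
  qed
  have \<alpha>_inj: "inj_on (\<alpha> n) T" for n
  proof
    fix u v assume "u \<in> T" "v \<in> T" "\<alpha> n u = \<alpha> n v"
    then show "u = v" using g_eq[of u v "n + 2"] by (auto simp: T_def \<alpha>_def reduce_eq_self)
  qed
  have \<alpha>_T: "\<alpha> n ` T = S n" for n
    by (auto simp: T_def S_def \<alpha>_x image_image)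
  have \<beta>_bij: "bij_betw (\<beta> n) (S n) T" for n
    unfolding \<beta>_def using \<alpha>_inj \<alpha>_T by (intro bij_betw_inv_into) (simp add: bij_betw_def)
  have "rooted_graph_iso (\<beta> n) (graph_ball (cayley_graph W (S n)) R) (graph_ball (cayley_graph ?F T) R)"
    \<comment> \<open>Testing an edge compares a word of length at most \<open>R\<close> with one of
      length at most \<open>R + 1\<close>.\<close>
    if n: "2 * R + 1 \<le> n" for n R
  proof (rule rooted_graph_iso_sym[where \<psi> = "\<alpha> n" and \<alpha> = "\<alpha> n"])
    let ?X = "graph_ball (cayley_graph W (S n)) R" and ?Y = "graph_ball (cayley_graph ?F T) R"
    have VX: "g_verts ?X = {word_eval W (g (n + 2)) w | w. fst ` set w \<subseteq> {..<k} \<and> length w \<le> R}"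
      unfolding S_def by (simp add: graph_ball_def ball_verts_cayley_graph[OF W g])
    have "g_verts ?Y = {word_eval ?F ?x w | w. fst ` set w \<subseteq> {..<k} \<and> length w \<le> R}"
      unfolding T_def by (simp add: graph_ball_def ball_verts_cayley_graph[OF F.is_group x])
    then have VY: "g_verts ?Y = {reduce w | w. fst ` set w \<subseteq> {..<k} \<and> length w \<le> R}"
      using word_eval_free_group by (auto simp: set_eq_iff; metis)
    have \<alpha>_red: "\<alpha> n (reduce w) = word_eval W (g (n + 2)) w" if "fst ` set w \<subseteq> {..<k}" for w
      using W.word_eval_reduce[OF g that] by (simp add: \<alpha>_def)
    show "bij_betw (\<alpha> n) (g_verts ?Y) (g_verts ?X)"
      unfolding bij_betw_def
    proof
      show "inj_on (\<alpha> n) (g_verts ?Y)"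
      proof
        fix u v assume "u \<in> g_verts ?Y" "v \<in> g_verts ?Y" and eq: "\<alpha> n u = \<alpha> n v"
        then obtain u' v' where "u = reduce u'" "v = reduce v'" "fst ` set u' \<subseteq> {..<k}" "fst ` set v' \<subseteq> {..<k}"
          "length u' \<le> R" "length v' \<le> R" unfolding VY by auto
        then show "u = v" using g_eq[of u' v' "n + 2"] eq \<alpha>_red n by simp
      qed
      show "\<alpha> n ` g_verts ?Y = g_verts ?X"
        unfolding VX VY using \<alpha>_red by (auto simp: image_iff; metis)
    qed
    show "\<alpha> n (g_root ?Y) = g_root ?X"
      by (simp add: \<alpha>_def graph_ball_def cayley_graph_def one_free_group)
    show "g_root ?Y \<in> g_verts ?Y"
      by (auto simp: graph_ball_def cayley_graph_def ball_verts_def intro!: exI[of _ 0])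
    have EX: "g_edges ?X = {(a, s, b). a \<in> g_verts ?X \<and> b \<in> g_verts ?X \<and> s \<in> S n \<and> b = a \<otimes>\<^bsub>W\<^esub> s}"
      by (auto simp: graph_ball_def cayley_graph_def ball_verts_def)
    have EY: "g_edges ?Y = {(a, s, b). a \<in> g_verts ?Y \<and> b \<in> g_verts ?Y \<and> s \<in> T \<and> b = a \<otimes>\<^bsub>?F\<^esub> s}"
      by (auto simp: graph_ball_def cayley_graph_def ball_verts_def)
    \<comment> \<open>Balls are induced subgraphs, so edges must be reflected as well as
      preserved.\<close>
    have edge: "\<alpha> n v = \<alpha> n u \<otimes>\<^bsub>W\<^esub> \<alpha> n s \<longleftrightarrow> v = u \<otimes>\<^bsub>?F\<^esub> s"
      if uvs: "u \<in> g_verts ?Y" "v \<in> g_verts ?Y" "s \<in> T" for u v s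
    proof -
      obtain u' v' where u: "u = reduce u'" "fst ` set u' \<subseteq> {..<k}" "length u' \<le> R"
        and v: "v = reduce v'" "fst ` set v' \<subseteq> {..<k}" "length v' \<le> R"
        using uvs unfolding VY by auto
      obtain i where i: "i < k" "s = [(i, True)]" using uvs by (auto simp: T_def)
      have "\<alpha> n u \<otimes>\<^bsub>W\<^esub> \<alpha> n s = word_eval W (g (n + 2)) (u' @ s)"
        using u i W.word_eval_append[OF g, of u' s "n + 2"] \<alpha>_red[of u'] by (simp add: \<alpha>_def)
      moreover have "u \<otimes>\<^bsub>?F\<^esub> s = reduce (u' @ s)"
        using u i word_eval_free_group[of "u' @ s" k] F.word_eval_append[OF x, of u' s]
          word_eval_free_group[of u' k] word_eval_free_group[of s k] by (simp add: reduce_eq_self)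
      ultimately show ?thesis
        using g_eq[of v' "u' @ s" "n + 2"] u v i n \<alpha>_red[of v'] by simp
    qed
    show "g_edges ?X = (\<lambda>(u, s, v). (\<alpha> n u, \<alpha> n s, \<alpha> n v)) ` g_edges ?Y"
    proof (intro equalityI subsetI)
      fix e assume "e \<in> g_edges ?X"
      then obtain a s b where e: "e = (a, s, b)" "a \<in> g_verts ?X" "b \<in> g_verts ?X" "s \<in> S n" "b = a \<otimes>\<^bsub>W\<^esub> s"
        by (auto simp: EX)
      have VX_eq: "g_verts ?X = \<alpha> n ` g_verts ?Y"
        using \<open>bij_betw (\<alpha> n) (g_verts ?Y) (g_verts ?X)\<close> by (simp add: bij_betw_def)
      obtain u where u: "a = \<alpha> n u" "u \<in> g_verts ?Y" using e(2) unfolding VX_eq by auto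
      obtain v where v: "b = \<alpha> n v" "v \<in> g_verts ?Y" using e(3) unfolding VX_eq by auto
      obtain r where r: "s = \<alpha> n r" "r \<in> T" using e(4) unfolding \<alpha>_T[symmetric] by auto
      have "(u, r, v) \<in> g_edges ?Y"
        using e edge[OF u(2) v(2) r(2)] u v r by (simp add: EY)
      then show "e \<in> (\<lambda>(u, s, v). (\<alpha> n u, \<alpha> n s, \<alpha> n v)) ` g_edges ?Y"
        using e(1) u v r by (intro rev_image_eqI[of "(u, r, v)"]) auto
    next
      fix e assume "e \<in> (\<lambda>(u, s, v). (\<alpha> n u, \<alpha> n s, \<alpha> n v)) ` g_edges ?Y"
      then obtain u s v where "e = (\<alpha> n u, \<alpha> n s, \<alpha> n v)" "u \<in> g_verts ?Y" "v \<in> g_verts ?Y" "s \<in> T"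
        "v = u \<otimes>\<^bsub>?F\<^esub> s"
        by (auto simp: EY)
      moreover from this have "\<alpha> n u \<in> g_verts ?X" "\<alpha> n v \<in> g_verts ?X" "\<alpha> n s \<in> S n"
        using \<open>bij_betw (\<alpha> n) (g_verts ?Y) (g_verts ?X)\<close> \<alpha>_T[of n] by (auto simp: bij_betw_def)
      moreover note edge[of u v s]
      ultimately show "e \<in> g_edges ?X" by (simp add: EX)
    qed
    show "u \<in> g_verts ?Y \<and> v \<in> g_verts ?Y \<and> \<beta> n (\<alpha> n s) = s" if "(u, s, v) \<in> g_edges ?Y" for u s v
      using that \<alpha>_inj[of n] by (auto simp: EY \<beta>_def)
  qed
  then show ?thesis
    unfolding preforms_def using T_gen \<beta>_bij g_gen
    by (intro exI[of _ T] exI[of _ S] exI[of _ \<beta>] conjI allI exI) (auto simp: T_def S_def)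
qed

section \<open>Restricted wreath products\<close>

lemma (in group) generating_set_mono:
  assumes "generating_set G S" "S \<subseteq> S'" "S' \<subseteq> carrier G"
  shows "generating_set G S'"
  using assms mono_generate[of S S'] generate_incl[of S'] by (auto simp: generating_set_def)

lemma (in group) finitely_generated_indexed:
  assumes "finitely_generated G"
  obtains s n where "2 \<le> n" "generating_set G (s ` {..<n::nat})"
proof -
  obtain S where S: "finite S" "generating_set G S"
    using assms by (auto simp: finitely_generated_def)
  obtain f where f: "bij_betw f {0..<card S} S"
    using ex_bij_betw_nat_finite[OF S(1)] by auto
  \<comment> \<open>Padding with the identity raises the number of indices to at least 2.\<close>
  define s where "s i = (if i < card S then f i else \<one>)" for i
  have fS: "f i \<in> S" if "i < card S" for i using f that by (auto simp: bij_betw_def)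
  have "S \<subseteq> s ` {..<card S + 2}"
  proof
    fix x assume "x \<in> S"
    then have "x \<in> f ` {0..<card S}" using f by (simp add: bij_betw_def)
    then obtain i where "i < card S" "x = f i" by auto
    then show "x \<in> s ` {..<card S + 2}" by (intro image_eqI[of _ _ i]) (auto simp: s_def)
  qed
  moreover have "s ` {..<card S + 2} \<subseteq> carrier G"
    using fS S(2) by (auto simp: s_def generating_set_def)
  ultimately have "generating_set G (s ` {..<card S + 2})"
    using generating_set_mono[OF S(2)] by blast
  then show thesis by (intro that[of "card S + 2" s]) simp_all
qed

text \<open>Dividing by \<open>z i\<close>, which lies in the subgroup generated by
  \<open>A'\<close>, recovers \<open>s i\<close>. Thus \<open>z i\<close> can be chosen freely in
  \<open>generate G A\<close> to adjust a generator without losing generation.\<close>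

lemma (in group) generating_set_twist:
  assumes s: "generating_set G (s ` I)" and A: "A \<subseteq> A'" "A' \<subseteq> carrier G"
    and z: "\<And>i. i \<in> I \<Longrightarrow> z i \<in> generate G A \<and> z i \<otimes> s i \<in> A'"
  shows "generating_set G A'"
proof -
  have sub: "subgroup (generate G A') G" using A by (intro generate_is_subgroup)
  have "s i \<in> generate G A'" if i: "i \<in> I" for i
  proof -
    have zi: "z i \<in> generate G A'" using z[OF i] mono_generate[OF A(1)] by auto
    moreover have "z i \<otimes> s i \<in> generate G A'" using z[OF i] by (auto intro: generate.incl)
    ultimately have "inv (z i) \<otimes> (z i \<otimes> s i) \<in> generate G A'"
      using sub by (simp add: subgroup_def)
    moreover have "z i \<in> carrier G" "s i \<in> carrier G"
      using zi generate_incl[OF A(2)] s i by (auto simp: generating_set_def)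
    ultimately show ?thesis by (simp add: m_assoc[symmetric])
  qed
  then have "generate G (s ` I) \<subseteq> generate G A'"
    using sub by (intro generate_subgroup_incl) auto
  then show ?thesis
    using s A generate_incl[OF A(2)] by (auto simp: generating_set_def)
qed

lemma (in group_hom) generate_img_surj:
  assumes "A \<subseteq> carrier G" "generating_set H (h ` A)" "y \<in> carrier H"
  obtains x where "x \<in> generate G A" "h x = y"
proof -
  have "y \<in> h ` generate G A"
    using assms generate_img[OF assms(1)] by (simp add: generating_set_def)
  with that show thesis by auto
qed

text \<open>The generators \<open>s j\<close> of \<open>G\<close> can be multiplied by elements of the subgroup generated by the
  lifts of \<open>h 0, \<dots>, h (k - 1)\<close>, so their images in \<open>H\<close> can be prescribed.\<close>

lemma not_almost_identity_lift:
  assumes \<pi>: "group_hom G H \<pi>" and surj: "\<pi> ` carrier G = carrier H"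
    and s: "generating_set G (s ` {..<r})" and k: "2 \<le> k"
    and na: "\<not> (\<exists>w. is_almost_identity H k w)"
  shows "\<not> is_almost_identity G (k + r) w"
proof
  interpret \<pi>: group_hom G H \<pi> by fact
  interpret F: group "free_group k" by (rule group_free_group)
  let ?I = "{..<k + r}"
  assume "is_almost_identity G (k + r) w"
  then have w: "w \<in> carrier (free_group (k + r))" "w \<noteq> []"
    and ai: "\<And>h. generating_set G (h ` ?I) \<Longrightarrow> word_eval G h w = \<one>\<^bsub>G\<^esub>"
    by (auto simp: is_almost_identity_def one_free_group)
  have wI: "fst ` set w \<subseteq> ?I" using w by (simp add: carrier_free_group)
  obtain y where y: "y \<in> ?I \<rightarrow> carrier (free_group k)" "\<And>i. i < k \<Longrightarrow> y i = [(i, True)]"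
    "word_eval (free_group k) y w \<in> carrier (free_group k)" "word_eval (free_group k) y w \<noteq> []"
    using ex_substitution[OF w k] by blast
  obtain h where h: "generating_set H (h ` {..<k})" "word_eval H h (word_eval (free_group k) y w) \<noteq> \<one>\<^bsub>H\<^esub>"
    using not_almost_identityD[OF na y(3,4)] by blast
  have hc: "h \<in> {..<k} \<rightarrow> carrier H" using h(1) by (auto simp: generating_set_def)
  have "\<forall>i. \<exists>x. i < k \<longrightarrow> x \<in> carrier G \<and> \<pi> x = h i"
  proof
    fix i
    show "\<exists>x. i < k \<longrightarrow> x \<in> carrier G \<and> \<pi> x = h i"
    proof (cases "i < k")
      case True
      then have "h i \<in> \<pi> ` carrier G" using hc surj by auto
      then show ?thesis by auto
    qed simp
  qed
  then obtain l where l: "\<And>i. i < k \<Longrightarrow> l i \<in> carrier G \<and> \<pi> (l i) = h i" by metis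
  let ?L = "l ` {..<k}"
  have L: "?L \<subseteq> carrier G" using l by auto
  have \<pi>L: "\<pi> ` ?L = h ` {..<k}" using l by (simp add: image_image)
  have sc: "s j \<in> carrier G" if "j < r" for j using s that by (auto simp: generating_set_def)
  \<comment> \<open>The correction \<open>z j\<close> moves the image of \<open>s j\<close> to the
    value of \<open>y (k + j)\<close> at \<open>h\<close>, as the substitution demands of letter
    \<open>k + j\<close>.\<close>
  have yH: "word_eval H h (y i) \<in> carrier H" if "i < k + r" for i
    using y(1) that by (intro \<pi>.H.word_eval_closed[OF hc]) (auto simp: carrier_free_group)
  have "\<exists>z. j < r \<longrightarrow> z \<in> generate G ?L \<and> \<pi> z = word_eval H h (y (k + j)) \<otimes>\<^bsub>H\<^esub> inv\<^bsub>H\<^esub> \<pi> (s j)" for j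
  proof (cases "j < r")
    case True
    then have "word_eval H h (y (k + j)) \<otimes>\<^bsub>H\<^esub> inv\<^bsub>H\<^esub> \<pi> (s j) \<in> carrier H" using yH sc by auto
    with \<pi>.generate_img_surj[OF L] show ?thesis using h(1) \<pi>L by metis
  qed simp
  then obtain z where z: "\<And>j. j < r \<Longrightarrow>
      z j \<in> generate G ?L \<and> \<pi> (z j) = word_eval H h (y (k + j)) \<otimes>\<^bsub>H\<^esub> inv\<^bsub>H\<^esub> \<pi> (s j)"
    by metis
  have zc: "z j \<in> carrier G" if "j < r" for j using z[OF that] \<pi>.G.generate_incl[OF L] by auto
  define a where "a i = (if i < k then l i else z (i - k) \<otimes>\<^bsub>G\<^esub> s (i - k))" for i
  have a: "a \<in> ?I \<rightarrow> carrier G" using l zc sc by (auto simp: a_def)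
  have "generating_set G (a ` ?I)"
  proof (rule \<pi>.G.generating_set_twist[OF s])
    show "?L \<subseteq> a ` ?I" by (auto simp: a_def image_iff intro!: bexI)
    show "a ` ?I \<subseteq> carrier G" using a by auto
    show "z j \<in> generate G ?L \<and> z j \<otimes>\<^bsub>G\<^esub> s j \<in> a ` ?I" if "j \<in> {..<r}" for j
      using z that by (auto simp: a_def image_iff intro!: bexI[of _ "k + j"])
  qed
  then have "\<pi> (word_eval G a w) = \<one>\<^bsub>H\<^esub>" using ai by simp
  then have "word_eval H (\<lambda>i. \<pi> (a i)) w = \<one>\<^bsub>H\<^esub>"
    using \<pi>.G.word_eval_hom[OF \<pi>.H.is_group \<pi>.homh a wI] by simp
  \<comment> \<open>The tuple \<open>a\<close> lies over the values of \<open>y\<close> at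
    \<open>h\<close>, so \<open>w\<close> takes there the non-trivial value of the substituted
    word.\<close>
  moreover have "word_eval H (\<lambda>i. \<pi> (a i)) w = word_eval H (\<lambda>i. word_eval H h (y i)) w"
  proof (rule word_eval_cong)
    fix i assume "i \<in> fst ` set w"
    then have i: "i < k + r" using wI by auto
    show "\<pi> (a i) = word_eval H h (y i)"
    proof (cases "i < k")
      case True
      then show ?thesis using l y(2) hc by (simp add: a_def letter_eval_def Pi_iff)
    next
      case False
      with i have "i - k < r" "k + (i - k) = i" by auto
      then show ?thesis using False z[of "i - k"] zc sc yH[OF i]
        by (simp add: a_def \<pi>.H.m_assoc)
    qed
  qed
  moreover have "\<dots> = word_eval H h (word_eval (free_group k) y w)"
    using \<pi>.H.word_eval_subst[OF hc y(1) wI] by simp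
  ultimately show False using h(2) by simp
qed

section \<open>Coordinates in the restricted wreath product\<close>

locale wreath = G: group G + H: group H
  for G :: "('a, 'c) monoid_scheme" and H :: "('b, 'd) monoid_scheme"
begin

abbreviation W where "W \<equiv> wreath_product G H"

sublocale W: group W
  by (rule group_wreath_product) unfold_locales

definition base :: "('b \<Rightarrow> 'a) set" where
  "base = {f \<in> carrier H \<rightarrow>\<^sub>E carrier G. finite {x \<in> carrier H. f x \<noteq> \<one>\<^bsub>G\<^esub>}}"

lemma carrier_W: "carrier W = base \<times> carrier H"
  by (simp add: wreath_product_def semidirect_product_def base_def carrier_sum_group G.is_group)

lemma one_W: "\<one>\<^bsub>W\<^esub> = (\<lambda>x\<in>carrier H. \<one>\<^bsub>G\<^esub>, \<one>\<^bsub>H\<^esub>)"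
  by (simp add: wreath_product_def semidirect_product_def)

lemma fst_closed: "p \<in> carrier W \<Longrightarrow> x \<in> carrier H \<Longrightarrow> fst p x \<in> carrier G"
  by (auto simp: carrier_W base_def)

lemma snd_closed: "p \<in> carrier W \<Longrightarrow> snd p \<in> carrier H"
  by (auto simp: carrier_W)

lemma snd_mult: "snd (p \<otimes>\<^bsub>W\<^esub> q) = snd p \<otimes>\<^bsub>H\<^esub> snd q"
  by (simp add: wreath_product_def semidirect_product_def split_beta)

lemma fst_mult:
  "x \<in> carrier H \<Longrightarrow> fst (p \<otimes>\<^bsub>W\<^esub> q) x = fst p x \<otimes>\<^bsub>G\<^esub> fst q (inv\<^bsub>H\<^esub> snd p \<otimes>\<^bsub>H\<^esub> x)"
  by (simp add: wreath_product_def semidirect_product_def split_beta shift_def)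

lemma W_eqI:
  assumes "p \<in> carrier W" "q \<in> carrier W" "snd p = snd q"
    and "\<And>x. x \<in> carrier H \<Longrightarrow> fst p x = fst q x"
  shows "p = q"
proof -
  have "fst p \<in> carrier H \<rightarrow>\<^sub>E carrier G" "fst q \<in> carrier H \<rightarrow>\<^sub>E carrier G"
    using assms(1,2) by (auto simp: carrier_W base_def)
  then have "fst p = fst q" using assms(4) by (rule PiE_ext)
  with assms(3) show ?thesis by (simp add: prod_eq_iff)
qed

lemma snd_group_hom: "group_hom W H snd"
  by (simp add: group_hom_def group_hom_axioms_def hom_def snd_mult snd_closed)

lemma snd_inv: "p \<in> carrier W \<Longrightarrow> snd (inv\<^bsub>W\<^esub> p) = inv\<^bsub>H\<^esub> snd p"
  using group_hom.hom_inv[OF snd_group_hom, of p] by simp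

lemma fst_inv:
  assumes p: "p \<in> carrier W" and x: "x \<in> carrier H"
  shows "fst (inv\<^bsub>W\<^esub> p) x = inv\<^bsub>G\<^esub> fst p (snd p \<otimes>\<^bsub>H\<^esub> x)"
proof -
  let ?y = "snd p \<otimes>\<^bsub>H\<^esub> x"
  have y: "?y \<in> carrier H" "inv\<^bsub>H\<^esub> snd p \<otimes>\<^bsub>H\<^esub> ?y = x"
    using p x snd_closed[OF p] by (simp_all add: H.m_assoc[symmetric])
  have "fst (p \<otimes>\<^bsub>W\<^esub> inv\<^bsub>W\<^esub> p) ?y = fst p ?y \<otimes>\<^bsub>G\<^esub> fst (inv\<^bsub>W\<^esub> p) x"
    using fst_mult[OF y(1)] y(2) by simp
  then have "fst p ?y \<otimes>\<^bsub>G\<^esub> fst (inv\<^bsub>W\<^esub> p) x = \<one>\<^bsub>G\<^esub>"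
    using p y by (simp add: one_W)
  then show ?thesis
    using fst_closed[OF p y(1)] fst_closed[OF W.inv_closed[OF p] x]
    by (metis G.inv_equality G.inv_inv G.inv_closed)
qed

lemma in_carrier_WI:
  assumes "h \<in> carrier H" "finite A" "\<And>x. x \<in> carrier H \<Longrightarrow> f x \<in> carrier G"
    "\<And>x. x \<in> carrier H \<Longrightarrow> x \<notin> A \<Longrightarrow> f x = \<one>\<^bsub>G\<^esub>"
  shows "(\<lambda>x\<in>carrier H. f x, h) \<in> carrier W"
proof -
  have "finite {x \<in> carrier H. f x \<noteq> \<one>\<^bsub>G\<^esub>}"
    by (rule finite_subset[OF _ assms(2)]) (use assms(4) in auto)
  moreover have "{x \<in> carrier H. (\<lambda>x\<in>carrier H. f x) x \<noteq> \<one>\<^bsub>G\<^esub>} = {x \<in> carrier H. f x \<noteq> \<one>\<^bsub>G\<^esub>}" by auto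
  ultimately show ?thesis using assms by (auto simp: carrier_W base_def)
qed

definition bump :: "'b \<Rightarrow> 'a \<Rightarrow> ('b \<Rightarrow> 'a) \<times> 'b" where
  "bump u g = (\<lambda>x\<in>carrier H. if x = u then g else \<one>\<^bsub>G\<^esub>, \<one>\<^bsub>H\<^esub>)"

definition emb :: "'b \<Rightarrow> ('b \<Rightarrow> 'a) \<times> 'b" where
  "emb h = (\<lambda>x\<in>carrier H. \<one>\<^bsub>G\<^esub>, h)"

lemma bump_emb_simps [simp]:
  "x \<in> carrier H \<Longrightarrow> fst (bump u g) x = (if x = u then g else \<one>\<^bsub>G\<^esub>)" "snd (bump u g) = \<one>\<^bsub>H\<^esub>"
  "x \<in> carrier H \<Longrightarrow> fst (emb h) x = \<one>\<^bsub>G\<^esub>" "snd (emb h) = h"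
  by (simp_all add: bump_def emb_def)

lemma bump_closed [simp]: "g \<in> carrier G \<Longrightarrow> bump u g \<in> carrier W"
  unfolding bump_def by (rule in_carrier_WI[of _ "{u}"]) auto

lemma emb_closed [simp]: "h \<in> carrier H \<Longrightarrow> emb h \<in> carrier W"
  unfolding emb_def by (rule in_carrier_WI[of _ "{}"]) auto

text \<open>Conjugation by \<open>emb u\<close> carries a bump at the identity to one at
  \<open>u\<close>. A finitely supported function is a finite product of bumps, and a factor
  \<open>emb h\<close> supplies the component in \<open>H\<close>.\<close>

lemma subgroup_eq_carrier_W:
  assumes K: "subgroup K W" and emb: "\<And>h. h \<in> carrier H \<Longrightarrow> emb h \<in> K"
    and bump: "\<And>g. g \<in> carrier G \<Longrightarrow> bump \<one>\<^bsub>H\<^esub> g \<in> K"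
  shows "K = carrier W"
proof
  show "K \<subseteq> carrier W" using K by (simp add: subgroup_def)
  have mult: "p \<otimes>\<^bsub>W\<^esub> q \<in> K" if "p \<in> K" "q \<in> K" for p q
    using subgroup.m_closed[OF K that] .
  have bump_u: "bump u g \<in> K" if "u \<in> carrier H" "g \<in> carrier G" for u g
  proof -
    have "bump u g = emb u \<otimes>\<^bsub>W\<^esub> (bump \<one>\<^bsub>H\<^esub> g \<otimes>\<^bsub>W\<^esub> emb (inv\<^bsub>H\<^esub> u))"
    proof (rule W_eqI)
      fix x assume x: "x \<in> carrier H"
      have "inv\<^bsub>H\<^esub> u \<otimes>\<^bsub>H\<^esub> x = \<one>\<^bsub>H\<^esub> \<longleftrightarrow> x = u"
        using x that by (metis H.inv_closed H.inv_equality H.inv_inv H.l_inv)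
      then show "fst (bump u g) x = fst (emb u \<otimes>\<^bsub>W\<^esub> (bump \<one>\<^bsub>H\<^esub> g \<otimes>\<^bsub>W\<^esub> emb (inv\<^bsub>H\<^esub> u))) x"
        using x that by (simp add: fst_mult)
    qed (use that in \<open>auto simp: snd_mult\<close>)
    then show ?thesis using mult emb bump that by simp
  qed
  \<comment> \<open>Induction over a finite set containing the support, splitting off one value at a
    time.\<close>
  have base_K: "(f, \<one>\<^bsub>H\<^esub>) \<in> K"
    if "finite A" "f \<in> base" "{x \<in> carrier H. f x \<noteq> \<one>\<^bsub>G\<^esub>} \<subseteq> A" for A f
    using that
  proof (induction A arbitrary: f rule: finite_induct)
    case empty
    then have "(f, \<one>\<^bsub>H\<^esub>) = \<one>\<^bsub>W\<^esub>"
      by (intro W_eqI W.one_closed) (auto simp: carrier_W one_W)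
    then show ?case using subgroup.one_closed[OF K] by simp
  next
    case (insert u A)
    show ?case
    proof (cases "u \<in> carrier H")
      case False
      then show ?thesis using insert by auto
    next
      case True
      let ?f = "\<lambda>x\<in>carrier H. if x = u then \<one>\<^bsub>G\<^esub> else f x"
      have f: "(f, \<one>\<^bsub>H\<^esub>) \<in> carrier W" using insert.prems by (simp add: carrier_W)
      have f': "(?f, \<one>\<^bsub>H\<^esub>) \<in> carrier W"
        using insert.prems fst_closed[OF f] insert.hyps(1) by (intro in_carrier_WI[of _ A]) auto
      have "(f, \<one>\<^bsub>H\<^esub>) = bump u (f u) \<otimes>\<^bsub>W\<^esub> (?f, \<one>\<^bsub>H\<^esub>)"
      proof (rule W_eqI)
        fix x assume "x \<in> carrier H"
        then show "fst (f, \<one>\<^bsub>H\<^esub>) x = fst (bump u (f u) \<otimes>\<^bsub>W\<^esub> (?f, \<one>\<^bsub>H\<^esub>)) x"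
          using fst_closed[OF f, of x] by (auto simp: fst_mult)
      qed (use f f' fst_closed[OF f True] in \<open>auto simp: snd_mult\<close>)
      moreover have "(?f, \<one>\<^bsub>H\<^esub>) \<in> K"
      proof (rule insert.IH)
        show "?f \<in> base" using f' by (simp add: carrier_W)
        show "{x \<in> carrier H. ?f x \<noteq> \<one>\<^bsub>G\<^esub>} \<subseteq> A" using insert.prems(2) by auto
      qed
      moreover have "bump u (f u) \<in> K"
        using bump_u[OF True] fst_closed[OF f True] by simp
      ultimately show ?thesis using mult by metis
    qed
  qed
  show "carrier W \<subseteq> K"
  proof
    fix p assume p: "p \<in> carrier W"
    then obtain f h where fh: "p = (f, h)" "f \<in> base" "h \<in> carrier H" by (auto simp: carrier_W)
    have f: "(f, \<one>\<^bsub>H\<^esub>) \<in> carrier W" using fh by (simp add: carrier_W)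
    have "p = (f, \<one>\<^bsub>H\<^esub>) \<otimes>\<^bsub>W\<^esub> emb h"
    proof (rule W_eqI)
      fix x assume "x \<in> carrier H"
      then show "fst p x = fst ((f, \<one>\<^bsub>H\<^esub>) \<otimes>\<^bsub>W\<^esub> emb h) x"
        using fh fst_closed[OF f, of x] by (simp add: fst_mult)
    qed (use p f fh in \<open>auto simp: snd_mult\<close>)
    moreover have "finite {x \<in> carrier H. f x \<noteq> \<one>\<^bsub>G\<^esub>}" using fh by (simp add: base_def)
    ultimately show "p \<in> K" using base_K[OF _ fh(2) subset_refl] mult emb[OF fh(3)] by metis
  qed
qed

text \<open>\<open>emb\<close> and \<open>bump\<close> at the identity are homomorphisms, so the
  images of finite generating sets yield both families required by
  \<open>subgroup_eq_carrier_W\<close>.\<close>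

lemma finitely_generated_W:
  assumes "finitely_generated G" "finitely_generated H"
  shows "finitely_generated W"
proof -
  obtain A B where A: "finite A" "generating_set G A" and B: "finite B" "generating_set H B"
    using assms by (auto simp: finitely_generated_def)
  have emb: "group_hom H W emb"
  proof (unfold_locales, rule homI)
    fix h h' assume "h \<in> carrier H" "h' \<in> carrier H"
    then show "emb (h \<otimes>\<^bsub>H\<^esub> h') = emb h \<otimes>\<^bsub>W\<^esub> emb h'"
      by (intro W_eqI) (auto simp: snd_mult fst_mult)
  qed simp
  have bump: "group_hom G W (bump \<one>\<^bsub>H\<^esub>)"
  proof (unfold_locales, rule homI)
    fix g g' assume "g \<in> carrier G" "g' \<in> carrier G"
    then show "bump \<one>\<^bsub>H\<^esub> (g \<otimes>\<^bsub>G\<^esub> g') = bump \<one>\<^bsub>H\<^esub> g \<otimes>\<^bsub>W\<^esub> bump \<one>\<^bsub>H\<^esub> g'"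
      by (intro W_eqI) (auto simp: snd_mult fst_mult)
  qed simp
  let ?S = "bump \<one>\<^bsub>H\<^esub> ` A \<union> emb ` B"
  have S: "?S \<subseteq> carrier W" using A B by (auto simp: generating_set_def)
  have "generate W ?S = carrier W"
  proof (rule subgroup_eq_carrier_W)
    show "subgroup (generate W ?S) W" using S by (rule W.generate_is_subgroup)
    fix h assume "h \<in> carrier H"
    then have "emb h \<in> generate W (emb ` B)"
      using group_hom.generate_img[OF emb, of B] B by (simp add: generating_set_def)
    then show "emb h \<in> generate W ?S" using W.mono_generate[of "emb ` B" ?S] by auto
  next
    fix g assume "g \<in> carrier G"
    then have "bump \<one>\<^bsub>H\<^esub> g \<in> generate W (bump \<one>\<^bsub>H\<^esub> ` A)"
      using group_hom.generate_img[OF bump, of A] A by (simp add: generating_set_def)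
    then show "bump \<one>\<^bsub>H\<^esub> g \<in> generate W ?S" using W.mono_generate[of "bump \<one>\<^bsub>H\<^esub> ` A" ?S] by auto
  qed
  with S A B show ?thesis
    unfolding finitely_generated_def generating_set_def by (intro exI[of _ ?S]) simp
qed

lemma snd_surj: "snd ` carrier W = carrier H"
proof -
  have "(\<lambda>x\<in>carrier H. \<one>\<^bsub>G\<^esub>) \<in> base" using W.one_closed by (simp add: carrier_W one_W)
  then show ?thesis by (auto simp: carrier_W image_iff)
qed

lemma snd_word_eval:
  "a \<in> I \<rightarrow> carrier W \<Longrightarrow> fst ` set w \<subseteq> I \<Longrightarrow> snd (word_eval W a w) = word_eval H (\<lambda>i. snd (a i)) w"
  using W.word_eval_hom[OF H.is_group group_hom.homh[OF snd_group_hom]] by metis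

text \<open>Evaluating the coordinate at \<open>x\<close> only reads the functions along the path from \<open>x\<close> labelled
  by \<open>w\<close>; if they are constant there, the coordinate is a value of \<open>w\<close> in \<open>G\<close>.\<close>

lemma fst_word_eval_const:
  assumes a: "a \<in> I \<rightarrow> carrier W" and g: "g \<in> I \<rightarrow> carrier G"
    and w: "fst ` set w \<subseteq> I" and x: "x \<in> carrier H"
    and eq: "\<And>i v. i \<in> I \<Longrightarrow> fst ` set v \<subseteq> I \<Longrightarrow> length v \<le> length w \<Longrightarrow>
      fst (a i) (word_eval H (\<lambda>i. snd (a i)) v \<otimes>\<^bsub>H\<^esub> x) = g i"
  shows "fst (word_eval W a w) x = word_eval G g w"
  using w x eq
proof (induction w arbitrary: x)
  case Nil
  then show ?case by (simp add: one_W)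
next
  case (Cons l w)
  let ?h = "\<lambda>i. snd (a i)"
  have h: "?h \<in> I \<rightarrow> carrier H" using a by (auto intro!: snd_closed)
  have l: "fst l \<in> I" using Cons.prems by auto
  \<comment> \<open>The first letter moves the point at which the rest of the word is read.\<close>
  let ?x = "letter_eval H ?h (inv_letter l) \<otimes>\<^bsub>H\<^esub> x"
  have x': "?x \<in> carrier H"
    using H.letter_eval_closed[OF h, of "inv_letter l"] l Cons.prems(2) by simp
  have IH: "fst (word_eval W a w) ?x = word_eval G g w"
  proof (rule Cons.IH[OF _ x'])
    fix i and v :: "letter list" assume iv: "i \<in> I" "fst ` set v \<subseteq> I" "length v \<le> length w"
    have "word_eval H ?h (v @ [inv_letter l]) \<otimes>\<^bsub>H\<^esub> x = word_eval H ?h v \<otimes>\<^bsub>H\<^esub> ?x"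
      using iv l Cons.prems(2) H.word_eval_closed[OF h iv(2)] H.letter_eval_closed[OF h, of "inv_letter l"]
      by (simp add: H.word_eval_append[OF h] H.m_assoc)
    then show "fst (a i) (word_eval H ?h v \<otimes>\<^bsub>H\<^esub> ?x) = g i"
      using Cons.prems(3)[of i "v @ [inv_letter l]"] iv l by simp
  qed (use Cons.prems in auto)
  have ai: "a (fst l) \<in> carrier W" "snd (a (fst l)) \<in> carrier H" "g (fst l) \<in> carrier G"
    using a h g l by auto
  have "inv\<^bsub>H\<^esub> snd (letter_eval W a l) \<otimes>\<^bsub>H\<^esub> x = ?x \<and> fst (letter_eval W a l) x = letter_eval G g l"
  proof (cases "snd l")
    case True
    then show ?thesis
      using Cons.prems(3)[of "fst l" "[]"] l Cons.prems(2) by (simp add: letter_eval_def inv_letter_def)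
  next
    \<comment> \<open>The base function of an inverse is read at the translated point, hence the
      one-letter word \<open>[(fst l, True)]\<close>.\<close>
    case False
    then show ?thesis
      using Cons.prems(3)[of "fst l" "[(fst l, True)]"] l Cons.prems(2) ai
      by (simp add: letter_eval_def inv_letter_def snd_inv fst_inv)
  qed
  then show ?case using IH by (simp add: fst_mult[OF Cons.prems(2)])
qed

text \<open>The support point \<open>t\<close> lies so far away from \<open>B\<close> that a translate of \<open>B \<union> {t}\<close> which
  takes \<open>t\<close> into \<open>B\<close> takes \<open>B\<close> off \<open>B\<close>.\<close>

lemma ex_subgroup_element_prescribed:
  assumes Y: "subgroup Y W" and B: "finite B" "B \<subseteq> carrier H" and t: "t \<in> carrier H"
    and far: "\<And>b b' b''. b \<in> B \<Longrightarrow> b' \<in> B \<Longrightarrow> b'' \<in> B \<Longrightarrow> t \<noteq> b'' \<otimes>\<^bsub>H\<^esub> inv\<^bsub>H\<^esub> b' \<otimes>\<^bsub>H\<^esub> b"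
    and surj: "snd ` Y = carrier H"
    and S: "generating_set G S"
    and YS: "\<And>g. g \<in> S \<Longrightarrow> \<exists>p\<in>Y. snd p = \<one>\<^bsub>H\<^esub> \<and> fst p t = g \<and>
        (\<forall>x\<in>carrier H. x \<notin> B \<longrightarrow> x \<noteq> t \<longrightarrow> fst p x = \<one>\<^bsub>G\<^esub>)"
    and \<phi>: "\<And>b. b \<in> B \<Longrightarrow> \<phi> b \<in> carrier G"
  obtains p where "p \<in> Y" "snd p = \<one>\<^bsub>H\<^esub>" "\<And>b. b \<in> B \<Longrightarrow> fst p b = \<phi> b"
proof -
  have YW: "p \<in> carrier W" if "p \<in> Y" for p using subgroup.mem_carrier[OF Y that] .
  \<comment> \<open>One coordinate at a time: triviality at the other points of \<open>B\<close>
    lets such elements be multiplied without interference.\<close>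
  have single: "\<exists>p\<in>Y. snd p = \<one>\<^bsub>H\<^esub> \<and> fst p b = \<gamma> \<and> (\<forall>b'\<in>B. b' \<noteq> b \<longrightarrow> fst p b' = \<one>\<^bsub>G\<^esub>)"
    if b: "b \<in> B" and \<gamma>: "\<gamma> \<in> carrier G" for b \<gamma>
  proof -
    have bH: "b \<in> carrier H" using b B by auto
    \<comment> \<open>The translation taking \<open>t\<close> to \<open>b\<close> reads the other
      coordinates in \<open>B\<close> at the points of \<open>D\<close>. By \<open>far\<close> these
      avoid \<open>B\<close>, and they avoid \<open>t\<close> because \<open>b'\<close> differs from
      \<open>b\<close>.\<close>
    define D where "D = {t \<otimes>\<^bsub>H\<^esub> inv\<^bsub>H\<^esub> b \<otimes>\<^bsub>H\<^esub> b' | b'. b' \<in> B \<and> b' \<noteq> b}"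
    have D: "x \<in> carrier H \<and> x \<notin> B \<and> x \<noteq> t" if xD: "x \<in> D" for x
    proof -
      obtain b' where b': "x = t \<otimes>\<^bsub>H\<^esub> inv\<^bsub>H\<^esub> b \<otimes>\<^bsub>H\<^esub> b'" "b' \<in> B" "b' \<noteq> b"
        using xD unfolding D_def by blast
      have b'H: "b' \<in> carrier H" using b' B by auto
      have teq: "t = x \<otimes>\<^bsub>H\<^esub> inv\<^bsub>H\<^esub> b' \<otimes>\<^bsub>H\<^esub> b"
        using b'(1) b'H bH t by (simp add: H.m_assoc)
      have xH: "x \<in> carrier H" using b'(1) t bH b'H by simp
      moreover have "x \<notin> B" using teq far[OF b b'(2)] by auto
      moreover have "x \<noteq> t"
      proof
        assume "x = t"
        then have "t \<otimes>\<^bsub>H\<^esub> (inv\<^bsub>H\<^esub> b \<otimes>\<^bsub>H\<^esub> b') = t" using b'(1) t bH b'H by (simp add: H.m_assoc)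
        then have "inv\<^bsub>H\<^esub> b \<otimes>\<^bsub>H\<^esub> b' = \<one>\<^bsub>H\<^esub>" using t bH b'H by simp
        then have "inv\<^bsub>H\<^esub> b = inv\<^bsub>H\<^esub> b'" using bH b'H by (simp add: H.inv_equality)
        then show False using b'(3) bH b'H H.inv_inv by metis
      qed
      ultimately show ?thesis by simp
    qed
    \<comment> \<open>Values on \<open>B\<close> are left uncontrolled, since only \<open>t\<close>
      and \<open>D\<close> matter after translation.\<close>
    have at_t: "\<exists>p\<in>Y. snd p = \<one>\<^bsub>H\<^esub> \<and> fst p t = g \<and> (\<forall>x\<in>D. fst p x = \<one>\<^bsub>G\<^esub>)"
      if "g \<in> carrier G" for g
    proof -
      have "g \<in> generate G S" using that S by (simp add: generating_set_def)
      then show ?thesis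
      proof (induction rule: generate.induct)
        case one
        have "\<one>\<^bsub>W\<^esub> \<in> Y" using Y by (rule subgroup.one_closed)
        then show ?case using t D by (intro bexI[of _ "\<one>\<^bsub>W\<^esub>"]) (auto simp: one_W)
      next
        case (incl g)
        then show ?case using YS[OF incl] D by metis
      next
        case (inv g)
        then obtain p where p: "p \<in> Y" "snd p = \<one>\<^bsub>H\<^esub>" "fst p t = g" "\<forall>x\<in>D. fst p x = \<one>\<^bsub>G\<^esub>"
          using YS[OF inv] D by metis
        then show ?case
          using D t subgroup.m_inv_closed[OF Y p(1)]
          by (intro bexI[of _ "inv\<^bsub>W\<^esub> p"]) (auto simp: snd_inv fst_inv YW)
      next
        case (eng g g')
        then obtain p q where p: "p \<in> Y" "snd p = \<one>\<^bsub>H\<^esub>" "fst p t = g" "\<forall>x\<in>D. fst p x = \<one>\<^bsub>G\<^esub>"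
          and q: "q \<in> Y" "snd q = \<one>\<^bsub>H\<^esub>" "fst q t = g'" "\<forall>x\<in>D. fst q x = \<one>\<^bsub>G\<^esub>"
          by auto
        then show ?case
          using D t subgroup.m_closed[OF Y p(1) q(1)]
          by (intro bexI[of _ "p \<otimes>\<^bsub>W\<^esub> q"]) (auto simp: snd_mult fst_mult)
      qed
    qed
    let ?h = "b \<otimes>\<^bsub>H\<^esub> inv\<^bsub>H\<^esub> t"
    have h: "?h \<in> carrier H" using bH t by simp
    then obtain q where q: "q \<in> Y" "snd q = ?h" using surj by (metis imageE)
    have qb: "fst q b \<in> carrier G" using fst_closed[OF YW[OF q(1)] bH] .
    \<comment> \<open>The base value of \<open>q\<close> at \<open>b\<close> conjugates the
      coordinate, so this is compensated in advance.\<close>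
    obtain p where p: "p \<in> Y" "snd p = \<one>\<^bsub>H\<^esub>" "fst p t = inv\<^bsub>G\<^esub> fst q b \<otimes>\<^bsub>G\<^esub> \<gamma> \<otimes>\<^bsub>G\<^esub> fst q b"
      "\<forall>x\<in>D. fst p x = \<one>\<^bsub>G\<^esub>"
      using at_t[of "inv\<^bsub>G\<^esub> fst q b \<otimes>\<^bsub>G\<^esub> \<gamma> \<otimes>\<^bsub>G\<^esub> fst q b"] qb \<gamma> by auto
    let ?c = "q \<otimes>\<^bsub>W\<^esub> p \<otimes>\<^bsub>W\<^esub> inv\<^bsub>W\<^esub> q"
    have "?c \<in> Y" using Y p q by (auto intro: subgroup.m_closed subgroup.m_inv_closed)
    moreover have "snd ?c = \<one>\<^bsub>H\<^esub>"
      using p(2) q h YW by (simp add: snd_mult snd_inv)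
    moreover have c: "fst ?c x = fst q x \<otimes>\<^bsub>G\<^esub> fst p (inv\<^bsub>H\<^esub> ?h \<otimes>\<^bsub>H\<^esub> x) \<otimes>\<^bsub>G\<^esub> inv\<^bsub>G\<^esub> fst q x"
      if "x \<in> carrier H" for x
    proof -
      have "?h \<otimes>\<^bsub>H\<^esub> (inv\<^bsub>H\<^esub> ?h \<otimes>\<^bsub>H\<^esub> x) = x" using h that by (simp only: H.m_assoc[symmetric] H.inv_closed H.r_inv H.l_one)
      then show ?thesis
        using that h p(2) q YW[OF q(1)] by (simp add: snd_mult fst_mult fst_inv)
    qed
    have "inv\<^bsub>H\<^esub> ?h = t \<otimes>\<^bsub>H\<^esub> inv\<^bsub>H\<^esub> b" using bH t by (simp add: H.inv_mult_group)
    then have "fst ?c b = \<gamma>"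
      using c[OF bH] p(3) qb \<gamma> bH t by (simp add: H.m_assoc G.m_assoc) (simp add: G.m_assoc[symmetric])
    moreover have "fst ?c b' = \<one>\<^bsub>G\<^esub>" if "b' \<in> B" "b' \<noteq> b" for b'
    proof -
      have b'H: "b' \<in> carrier H" using that B by auto
      have "inv\<^bsub>H\<^esub> ?h \<otimes>\<^bsub>H\<^esub> b' \<in> D"
        using that \<open>inv\<^bsub>H\<^esub> ?h = t \<otimes>\<^bsub>H\<^esub> inv\<^bsub>H\<^esub> b\<close> by (auto simp: D_def)
      then show ?thesis using c[OF b'H] p(4) fst_closed[OF YW[OF q(1)] b'H] by simp
    qed
    ultimately show ?thesis by blast
  qed
  have "\<exists>p\<in>Y. snd p = \<one>\<^bsub>H\<^esub> \<and> (\<forall>b\<in>C. fst p b = \<phi> b) \<and> (\<forall>b\<in>B - C. fst p b = \<one>\<^bsub>G\<^esub>)"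
    if "finite C" "C \<subseteq> B" for C
    using that
  proof (induction C rule: finite_induct)
    case empty
    have "\<one>\<^bsub>W\<^esub> \<in> Y" using Y by (rule subgroup.one_closed)
    then show ?case using B by (intro bexI[of _ "\<one>\<^bsub>W\<^esub>"]) (auto simp: one_W)
  next
    case (insert b C)
    then obtain p where p: "p \<in> Y" "snd p = \<one>\<^bsub>H\<^esub>" "\<forall>b\<in>C. fst p b = \<phi> b" "\<forall>b\<in>B - C. fst p b = \<one>\<^bsub>G\<^esub>"
      by auto
    obtain q where q: "q \<in> Y" "snd q = \<one>\<^bsub>H\<^esub>" "fst q b = \<phi> b" "\<forall>b'\<in>B. b' \<noteq> b \<longrightarrow> fst q b' = \<one>\<^bsub>G\<^esub>"
      using single[of b "\<phi> b"] \<phi> insert.prems by auto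
    have eq: "fst (p \<otimes>\<^bsub>W\<^esub> q) x = fst p x \<otimes>\<^bsub>G\<^esub> fst q x" if "x \<in> B" for x
      using that B p(2) by (subst fst_mult) auto
    show ?case
    proof (intro bexI[of _ "p \<otimes>\<^bsub>W\<^esub> q"] conjI ballI)
      show "p \<otimes>\<^bsub>W\<^esub> q \<in> Y" using Y p(1) q(1) by (rule subgroup.m_closed)
      show "snd (p \<otimes>\<^bsub>W\<^esub> q) = \<one>\<^bsub>H\<^esub>" using p q by (simp add: snd_mult)
      show "fst (p \<otimes>\<^bsub>W\<^esub> q) x = \<phi> x" if "x \<in> insert b C" for x
      proof (cases "x = b")
        case True
        then show ?thesis using insert p q eq[of b] \<phi>[of b] by simp
      next
        case False
        then have "x \<in> C" "x \<in> B" using that insert.prems by auto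
        then show ?thesis using False p q eq[of x] \<phi>[of x] by simp
      qed
      show "fst (p \<otimes>\<^bsub>W\<^esub> q) x = \<one>\<^bsub>G\<^esub>" if "x \<in> B - insert b C" for x
        using that p q eq[of x] by simp
    qed
  qed
  from this[OF B(1) subset_refl] that show thesis by auto
qed

text \<open>The tuple consists of \<open>N\<close> corrected generators of \<open>W\<close>,
  \<open>r\<close> elements lying over generators of \<open>H\<close>, and \<open>d\<close> elements
  carrying generators of \<open>G\<close> at a remote point \<open>t\<close>. The last two groups
  generate a subgroup large enough to contain the corrections.\<close>

lemma not_almost_identity_if_no_identity:
  assumes inf: "infinite (carrier H)" and ni: "\<not> satisfies_identity G"
    and S: "generating_set W (s ` {..<N})" and hs: "generating_set H (hs ` {..<r})"
    and gs: "generating_set G (gs ` {..<d})"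
  shows "\<not> is_almost_identity W (N + r + d) w"
proof
  let ?m = "N + r + d"
  let ?I = "{..<?m}"
  assume "is_almost_identity W ?m w"
  then have w: "w \<in> carrier (free_group ?m)" "w \<noteq> []"
    and ai: "\<And>h. generating_set W (h ` ?I) \<Longrightarrow> word_eval W h w = \<one>\<^bsub>W\<^esub>"
    by (auto simp: is_almost_identity_def one_free_group)
  have wI: "fst ` set w \<subseteq> ?I" using w by (simp add: carrier_free_group)
  have "\<not> is_identity G ?m w" using ni by (auto simp: satisfies_identity_def)
  then obtain g where g: "g ` ?I \<subseteq> carrier G" "word_eval G g w \<noteq> \<one>\<^bsub>G\<^esub>"
    using w by (auto simp: is_identity_def one_free_group)
  have gI: "g \<in> ?I \<rightarrow> carrier G" using g by auto
  have sW: "s i \<in> carrier W" if "i < N" for i using S that by (auto simp: generating_set_def)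
  have hsH: "hs i \<in> carrier H" if "i < r" for i using hs that by (auto simp: generating_set_def)
  have gsG: "gs i \<in> carrier G" if "i < d" for i using gs that by (auto simp: generating_set_def)
  \<comment> \<open>The components in \<open>H\<close> are fixed first, so the set \<open>B\<close>
    of points reached by words no longer than \<open>w\<close> is independent of the base values
    chosen later.\<close>
  define hc where "hc i = (if i < N then snd (s i) else if i < N + r then hs (i - N) else \<one>\<^bsub>H\<^esub>)" for i
  have hc: "hc \<in> ?I \<rightarrow> carrier H" using sW hsH snd_closed by (auto simp: hc_def)
  define B where "B = word_eval H hc ` {v. fst ` set v \<subseteq> ?I \<and> length v \<le> length w}"
  have "{v :: letter list. fst ` set v \<subseteq> ?I \<and> length v \<le> length w} \<subseteq> {v. set v \<subseteq> ?I \<times> UNIV \<and> length v \<le> length w}"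
    by auto
  then have "finite {v :: letter list. fst ` set v \<subseteq> ?I \<and> length v \<le> length w}"
    by (rule finite_subset) (intro finite_lists_length_le finite_cartesian_product; simp)
  then have Bfin: "finite B" by (simp add: B_def)
  have BH: "B \<subseteq> carrier H" using H.word_eval_closed[OF hc] by (auto simp: B_def)
  \<comment> \<open>Only finitely many positions of \<open>t\<close> are forbidden, and
    \<open>H\<close> is infinite.\<close>
  have "finite ((\<lambda>(b, b', b''). b'' \<otimes>\<^bsub>H\<^esub> inv\<^bsub>H\<^esub> b' \<otimes>\<^bsub>H\<^esub> b) ` (B \<times> B \<times> B))" using Bfin by simp
  then obtain t where t: "t \<in> carrier H"
    "t \<notin> (\<lambda>(b, b', b''). b'' \<otimes>\<^bsub>H\<^esub> inv\<^bsub>H\<^esub> b' \<otimes>\<^bsub>H\<^esub> b) ` (B \<times> B \<times> B)"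
    using inf by (meson finite_subset subsetI)
  have far: "t \<noteq> b'' \<otimes>\<^bsub>H\<^esub> inv\<^bsub>H\<^esub> b' \<otimes>\<^bsub>H\<^esub> b" if "b \<in> B" "b' \<in> B" "b'' \<in> B" for b b' b''
    using t(2) that by (auto simp: image_iff)
  have tB: "t \<notin> B"
  proof
    assume tB: "t \<in> B"
    then have "t = t \<otimes>\<^bsub>H\<^esub> inv\<^bsub>H\<^esub> t \<otimes>\<^bsub>H\<^esub> t" using t(1) by simp
    with far[OF tB tB tB] show False by simp
  qed
  \<comment> \<open>These members have the prescribed values on \<open>B\<close> from the outset;
    only the first \<open>N\<close> need correction.\<close>
  define yH where "yH j = (\<lambda>x\<in>carrier H. if x \<in> B then g (N + j) else \<one>\<^bsub>G\<^esub>, hs j)" for j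
  define yG where "yG j = (\<lambda>x\<in>carrier H. if x \<in> B then g (N + r + j) else if x = t then gs j else \<one>\<^bsub>G\<^esub>, \<one>\<^bsub>H\<^esub>)" for j
  have yH: "yH j \<in> carrier W" if "j < r" for j
    unfolding yH_def using that hsH gI Bfin by (intro in_carrier_WI[of _ B]) auto
  have yG: "yG j \<in> carrier W" if "j < d" for j
    unfolding yG_def using that gsG gI Bfin by (intro in_carrier_WI[of _ "insert t B"]) auto
  define A where "A = yH ` {..<r} \<union> yG ` {..<d}"
  have A: "A \<subseteq> carrier W" using yH yG by (auto simp: A_def)
  have Y: "subgroup (generate W A) W" using A by (rule W.generate_is_subgroup)
  have sndY: "snd ` generate W A = carrier H"
  proof -
    have "hs ` {..<r} \<subseteq> snd ` A" by (auto simp: A_def yH_def image_Un image_image)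
    moreover have "snd ` A \<subseteq> carrier H" using A by (auto intro!: snd_closed)
    ultimately have "generating_set H (snd ` A)"
      using H.generating_set_mono[OF hs] by blast
    then show ?thesis
      using group_hom.generate_img[OF snd_group_hom A] by (simp add: generating_set_def)
  qed
  \<comment> \<open>A left factor with trivial component in \<open>H\<close> keeps that of
    \<open>s i\<close> and turns its values on \<open>B\<close> into \<open>g i\<close>.\<close>
  have "\<exists>z. i < N \<longrightarrow> z \<in> generate W A \<and> snd z = \<one>\<^bsub>H\<^esub> \<and> (\<forall>b\<in>B. fst z b = g i \<otimes>\<^bsub>G\<^esub> inv\<^bsub>G\<^esub> fst (s i) b)" for i
  proof (cases "i < N")
    case True
    show ?thesis
    proof (rule ex_subgroup_element_prescribed[OF Y Bfin BH t(1) far sndY gs])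
      fix \<gamma> assume "\<gamma> \<in> gs ` {..<d}"
      then obtain j where j: "j < d" "\<gamma> = gs j" by auto
      then have "yG j \<in> generate W A" by (auto simp: A_def intro: generate.incl)
      then show "\<exists>p\<in>generate W A. snd p = \<one>\<^bsub>H\<^esub> \<and> fst p t = \<gamma> \<and>
          (\<forall>x\<in>carrier H. x \<notin> B \<longrightarrow> x \<noteq> t \<longrightarrow> fst p x = \<one>\<^bsub>G\<^esub>)"
        using j t(1) tB by (intro bexI[of _ "yG j"]) (auto simp: yG_def)
    next
      fix b assume "b \<in> B"
      then show "g i \<otimes>\<^bsub>G\<^esub> inv\<^bsub>G\<^esub> fst (s i) b \<in> carrier G"
        using True gI fst_closed[OF sW[OF True], of b] BH by (intro G.m_closed G.inv_closed) auto
    qed auto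
  qed simp
  then obtain z where z: "\<And>i. i < N \<Longrightarrow> z i \<in> generate W A \<and> snd (z i) = \<one>\<^bsub>H\<^esub> \<and>
      (\<forall>b\<in>B. fst (z i) b = g i \<otimes>\<^bsub>G\<^esub> inv\<^bsub>G\<^esub> fst (s i) b)"
    by metis
  have zW: "z i \<in> carrier W" if "i < N" for i using z[OF that] W.generate_incl[OF A] by auto
  define a where "a i = (if i < N then z i \<otimes>\<^bsub>W\<^esub> s i else if i < N + r then yH (i - N) else yG (i - N - r))" for i
  have a: "a \<in> ?I \<rightarrow> carrier W" using zW sW yH yG by (auto simp: a_def)
  have "generating_set W (a ` ?I)"
  proof (rule W.generating_set_twist[OF S])
    have "yH j \<in> a ` ?I" if "j < r" for j
      using that by (intro image_eqI[of _ _ "N + j"]) (auto simp: a_def)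
    moreover have "yG j \<in> a ` ?I" if "j < d" for j
      using that by (intro image_eqI[of _ _ "N + r + j"]) (auto simp: a_def)
    ultimately show "A \<subseteq> a ` ?I" by (auto simp: A_def)
    show "a ` ?I \<subseteq> carrier W" using a by auto
    show "z i \<in> generate W A \<and> z i \<otimes>\<^bsub>W\<^esub> s i \<in> a ` ?I" if "i \<in> {..<N}" for i
      using that z by (auto simp: a_def intro!: image_eqI[of _ _ i])
  qed
  then have "word_eval W a w = \<one>\<^bsub>W\<^esub>" by (rule ai)
  \<comment> \<open>Starting at the identity, the evaluation reads base values only in
    \<open>B\<close>, where the \<open>i\<close>-th function is constantly
    \<open>g i\<close>.\<close>
  moreover have "fst (word_eval W a w) \<one>\<^bsub>H\<^esub> = word_eval G g w"
  proof (rule fst_word_eval_const[OF a gI wI H.one_closed])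
    fix i and v :: "letter list" assume i: "i \<in> ?I" and v: "fst ` set v \<subseteq> ?I" "length v \<le> length w"
    have "word_eval H (\<lambda>i. snd (a i)) v = word_eval H hc v"
    proof (rule word_eval_cong)
      fix i assume "i \<in> fst ` set v"
      then have "i < ?m" using v by auto
      then show "snd (a i) = hc i"
        using z sW snd_closed by (auto simp: a_def hc_def snd_mult yH_def yG_def)
    qed
    moreover have b: "word_eval H hc v \<in> B" using v by (auto simp: B_def)
    moreover have "fst (a i) b = g i" if b: "b \<in> B" for b
    proof -
      have bH: "b \<in> carrier H" using b BH by auto
      consider "i < N" | "N \<le> i" "i < N + r" | "N + r \<le> i" by linarith
      then show ?thesis
      proof cases
        case 1
        then have "fst (a i) b = fst (z i) b \<otimes>\<^bsub>G\<^esub> fst (s i) b"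
          using z[OF 1] bH by (simp add: a_def fst_mult)
        then show ?thesis
          using z[OF 1] b 1 fst_closed[OF sW[OF 1] bH] gI i by (auto simp: G.m_assoc Pi_iff)
      qed (use b bH i in \<open>auto simp: a_def yH_def yG_def\<close>)
    qed
    ultimately show "fst (a i) (word_eval H (\<lambda>i. snd (a i)) v \<otimes>\<^bsub>H\<^esub> \<one>\<^bsub>H\<^esub>) = g i"
      using BH by (metis H.r_one subsetD)
  qed
  ultimately show False using g(2) by (simp add: one_W)
qed

end

section \<open>An almost-identity of the wreath product\<close>

lemma reduced_concat_map:
  assumes "\<And>a. B a \<noteq> [] \<and> reduced (B a)"
    and "\<And>a b. b \<noteq> inv_letter a \<Longrightarrow> hd (B b) \<noteq> inv_letter (last (B a))"
    and "reduced u"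
  shows "reduced (concat (map B u))"
  using assms(3)
proof (induction u)
  case (Cons a u)
  then show ?case
    using assms(1)[of a] assms(1)[of "hd u"] assms(2)[of "hd u" a]
    by (cases u) (auto simp: reduced_append reduced_Cons)
qed simp

text \<open>The two fresh letters per variable make the concatenation of the blocks of a reduced word
  reduced.\<close>

definition conj_block :: "nat \<Rightarrow> letter list \<Rightarrow> letter \<Rightarrow> letter list" where
  "conj_block k v a =
    (let i = k + 2 * fst a;
         z = (i, True) # v @ [(i, False), (Suc i, True)] @ v @ [(Suc i, False)]
     in if snd a then z else inv_word z)"

text \<open>Blocks begin with a positive and end with a negative letter. A junction cancels only if
  the fresh indices agree; their parity then shows that the two blocks belong to mutually inverse
  letters.\<close>

lemma hd_conj_block: "hd (conj_block k v (i, b)) = (if b then (k + 2 * i, True) else (Suc (k + 2 * i), True))"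
  and last_conj_block: "last (conj_block k v (i, b)) = (if b then (Suc (k + 2 * i), False) else (k + 2 * i, False))"
  and conj_block_neq_Nil: "conj_block k v a \<noteq> []"
  by (auto simp: conj_block_def Let_def inv_letter_def)

lemma reduced_conj_block:
  assumes v: "v \<in> carrier (free_group k)" "v \<noteq> []"
  shows "reduced (conj_block k v a)"
proof -
  have "fst ` set v \<subseteq> {..<k}" using v by (simp add: carrier_free_group)
  then have "fst (hd v) < k" "fst (last v) < k"
    using hd_in_set[OF v(2)] last_in_set[OF v(2)] by blast+
  then have "reduced ((i, True) # v @ [(i, False), (Suc i, True)] @ v @ [(Suc i, False)])"
    if "k \<le> i" for i
    using v that by (auto simp: reduced_append reduced_Cons inv_letter_def carrier_free_group)
  from this[of "k + 2 * fst a"] show ?thesis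
    unfolding conj_block_def Let_def by (simp only: reduced_inv_word le_add1 if_split simp_thms)
qed

context wreath
begin

text \<open>Conjugates of values of \<open>v\<close> at a generating tuple lie in the base group, so
  all blocks do. There words are evaluated coordinatewise in \<open>G\<close>, and \<open>u\<close>
  vanishes. The fresh conjugating letters are removed by substitution.\<close>

lemma ex_almost_identity:
  assumes u: "is_identity G n u" and v: "is_almost_identity H k v" and k: "2 \<le> k"
  shows "\<exists>c. is_almost_identity W k c"
proof -
  have uF: "u \<in> carrier (free_group n)" "u \<noteq> []"
    and u_id: "\<And>g. g ` {..<n} \<subseteq> carrier G \<Longrightarrow> word_eval G g u = \<one>\<^bsub>G\<^esub>"
    using u by (auto simp: is_identity_def one_free_group)
  have vF: "v \<in> carrier (free_group k)" "v \<noteq> []"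
    and v_id: "\<And>h. generating_set H (h ` {..<k}) \<Longrightarrow> word_eval H h v = \<one>\<^bsub>H\<^esub>"
    using v by (auto simp: is_almost_identity_def one_free_group)
  let ?I = "{..<k + 2 * n}"
  define z where "z = concat (map (conj_block k v) u)"
  have "reduced z"
    unfolding z_def
  proof (rule reduced_concat_map)
    show "conj_block k v a \<noteq> [] \<and> reduced (conj_block k v a)" for a
      using reduced_conj_block[OF vF] conj_block_neq_Nil by simp
    show "hd (conj_block k v b) \<noteq> inv_letter (last (conj_block k v a))" if "b \<noteq> inv_letter a" for a b
      using that by (cases a; cases b) (auto simp: hd_conj_block last_conj_block inv_letter_def, presburger+)
    show "reduced u" using uF by (simp add: carrier_free_group)
  qed
  have block_set: "fst ` set (conj_block k v (i, b)) \<subseteq> ?I" if "i < n" for i b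
  proof -
    have "fst ` set v \<subseteq> ?I" using vF by (auto simp: carrier_free_group)
    moreover have "Suc (k + 2 * i) < k + 2 * n" using that by simp
    ultimately show ?thesis
      unfolding conj_block_def Let_def
      by (cases b) (simp_all add: image_Un inv_letter_def)
  qed
  have un: "fst ` set u \<subseteq> {..<n}" using uF by (simp add: carrier_free_group)
  have "fst ` set z \<subseteq> ?I"
  proof
    fix j assume "j \<in> fst ` set z"
    then obtain a where "a \<in> set u" "j \<in> fst ` set (conj_block k v a)" by (auto simp: z_def)
    then show "j \<in> ?I" using block_set[of "fst a" "snd a"] un by auto
  qed
  with \<open>reduced z\<close> have zF: "z \<in> carrier (free_group (k + 2 * n))" by (simp add: carrier_free_group)
  have "z \<noteq> []" using uF(2) conj_block_neq_Nil by (cases u) (auto simp: z_def)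
  then obtain y where y: "y \<in> ?I \<rightarrow> carrier (free_group k)" "\<And>i. i < k \<Longrightarrow> y i = [(i, True)]"
    "word_eval (free_group k) y z \<in> carrier (free_group k)" "word_eval (free_group k) y z \<noteq> []"
    using ex_substitution[OF zF _ k] by blast
  have "word_eval W h (word_eval (free_group k) y z) = \<one>\<^bsub>W\<^esub>"
    if gen: "generating_set W (h ` {..<k})" for h
  proof -
    have h: "h \<in> {..<k} \<rightarrow> carrier W" using gen by (auto simp: generating_set_def)
    \<comment> \<open>\<open>p\<close> extends the tuple \<open>h\<close> by the values substituted
      for the fresh letters.\<close>
    define p where "p i = word_eval W h (y i)" for i
    have p: "p \<in> ?I \<rightarrow> carrier W"
      using y(1) by (auto simp: p_def carrier_free_group Pi_iff intro!: W.word_eval_closed[OF h])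
    have p_h: "p i = h i" if "i < k" for i
      using that y(2) h by (auto simp: p_def letter_eval_def Pi_iff)
    have vI: "fst ` set v \<subseteq> ?I" "fst ` set v \<subseteq> {..<k}" using vF by (auto simp: carrier_free_group)
    have "snd ` h ` {..<k} \<subseteq> carrier H" using h by (auto intro!: snd_closed)
    then have "generating_set H (snd ` h ` {..<k})"
      using gen snd_surj group_hom.generate_img[OF snd_group_hom, of "h ` {..<k}"]
      by (simp add: generating_set_def)
    then have "word_eval H (\<lambda>i. snd (h i)) v = \<one>\<^bsub>H\<^esub>"
      by (intro v_id) (simp add: image_image)
    moreover have "word_eval W p v = word_eval W h v"
      using vI p_h by (intro word_eval_cong) auto
    ultimately have snd_v: "snd (word_eval W p v) = \<one>\<^bsub>H\<^esub>"
      using snd_word_eval[OF h vI(2)] by simp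
    define q where "q i = word_eval W p (conj_block k v (i, True))" for i
    have q: "q \<in> {..<n} \<rightarrow> carrier W"
      using W.word_eval_closed[OF p block_set] by (simp add: q_def)
    have q_snd: "snd (q i) = \<one>\<^bsub>H\<^esub>" if "i < n" for i
    proof -
      let ?j = "k + 2 * i"
      have j: "?j \<in> ?I" "Suc ?j \<in> ?I" using that by auto
      then have pj: "p ?j \<in> carrier W" "p (Suc ?j) \<in> carrier W" "word_eval W p v \<in> carrier W"
        using p W.word_eval_closed[OF p vI(1)] by auto
      have "q i = p ?j \<otimes>\<^bsub>W\<^esub> (word_eval W p v \<otimes>\<^bsub>W\<^esub> (inv\<^bsub>W\<^esub> p ?j \<otimes>\<^bsub>W\<^esub>
          (p (Suc ?j) \<otimes>\<^bsub>W\<^esub> (word_eval W p v \<otimes>\<^bsub>W\<^esub> inv\<^bsub>W\<^esub> p (Suc ?j)))))"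
        using vI j pj by (simp add: q_def conj_block_def Let_def W.word_eval_append[OF p] letter_eval_def)
      then show ?thesis
        using pj snd_v snd_closed by (simp add: snd_mult snd_inv)
    qed
    have "word_eval W p (concat (map (conj_block k v) u')) = word_eval W q u'"
      if "fst ` set u' \<subseteq> {..<n}" for u'
      using that
    proof (induction u')
      case (Cons a u')
      have a: "fst a < n" using Cons.prems by auto
      have "fst ` set (concat (map (conj_block k v) u')) \<subseteq> ?I"
      proof
        fix j assume "j \<in> fst ` set (concat (map (conj_block k v) u'))"
        then obtain a where "a \<in> set u'" "j \<in> fst ` set (conj_block k v a)" by auto
        then show "j \<in> ?I" using block_set[of "fst a" "snd a"] Cons.prems by auto
      qed
      moreover have "word_eval W p (conj_block k v a) = letter_eval W q a"
      proof (cases "snd a")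
        case True
        then show ?thesis by (metis letter_eval_def prod.collapse q_def)
      next
        case False
        then have "conj_block k v a = inv_word (conj_block k v (fst a, True))"
          by (simp add: conj_block_def Let_def)
        then show ?thesis
          using False W.word_eval_inv_word[OF p block_set[OF a]] by (simp add: letter_eval_def q_def)
      qed
      ultimately show ?case
        using Cons block_set[OF a, of "snd a"] W.word_eval_append[OF p, of "conj_block k v a"] by simp
    qed simp
    then have pz: "word_eval W p z = word_eval W q u" using un by (simp add: z_def)
    \<comment> \<open>Trivial components in \<open>H\<close> cause no shift, so each coordinate is
      evaluated on its own.\<close>
    have q_word: "snd (word_eval W q u') = \<one>\<^bsub>H\<^esub> \<and>
        (\<forall>x\<in>carrier H. fst (word_eval W q u') x = word_eval G (\<lambda>i. fst (q i) x) u')"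
      if "fst ` set u' \<subseteq> {..<n}" for u'
      using that
    proof (induction u')
      case Nil
      then show ?case by (simp add: one_W)
    next
      case (Cons a u')
      have a: "fst a < n" using Cons.prems by auto
      have qa: "q (fst a) \<in> carrier W" using q a by auto
      have "snd (letter_eval W q a) = \<one>\<^bsub>H\<^esub>"
        using q_snd[OF a] qa by (simp add: letter_eval_def snd_inv)
      moreover have "fst (letter_eval W q a) x = letter_eval G (\<lambda>i. fst (q i) x) a" if "x \<in> carrier H" for x
        using q_snd[OF a] qa that by (simp add: letter_eval_def fst_inv)
      ultimately show ?case using Cons by (simp add: snd_mult fst_mult)
    qed
    have "word_eval W q u = \<one>\<^bsub>W\<^esub>"
    proof (rule W_eqI)
      show "word_eval W q u \<in> carrier W" using W.word_eval_closed[OF q un] .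
      show "snd (word_eval W q u) = snd \<one>\<^bsub>W\<^esub>" using q_word[OF un] by (simp add: one_W)
      show "fst (word_eval W q u) x = fst \<one>\<^bsub>W\<^esub> x" if x: "x \<in> carrier H" for x
      proof -
        have "(\<lambda>i. fst (q i) x) ` {..<n} \<subseteq> carrier G" using q x by (auto intro!: fst_closed)
        from u_id[OF this] show ?thesis using q_word[OF un] x by (simp add: one_W)
      qed
    qed simp
    then show ?thesis
      using W.word_eval_subst[OF h y(1), of z] zF pz
      by (simp add: carrier_free_group p_def[abs_def])
  qed
  with y show ?thesis by (auto simp: is_almost_identity_def one_free_group)
qed

end

theorem proposition4:
  fixes G :: "('a, 'c) monoid_scheme" and H :: "('b, 'd) monoid_scheme"
  assumes "group G" and "group H"
    and "finitely_generated G" and "finitely_generated H"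
    and "infinite (carrier H)"
  shows "(\<exists>k\<ge>2. preforms (wreath_product G H) (free_group k)) \<longleftrightarrow>
         \<not> satisfies_identity G \<or> \<not> satisfies_almost_identity H"
proof -
  interpret wreath G H using assms by (simp add: wreath_def)
  have preforms_iff: "preforms W (free_group k) \<longleftrightarrow> \<not> (\<exists>w. is_almost_identity W k w)" if "2 \<le> k" for k
    using preforms_free_group_imp_not_almost_identity[OF W.is_group]
      preforms_free_group_if_not_almost_identity[OF W.is_group that] by blast
  \<comment> \<open>\<open>2 \<le> N\<close> ensures that the rank \<open>N + r + d\<close> used
    below is at least 2.\<close>
  obtain s N where s: "2 \<le> N" "generating_set W (s ` {..<N::nat})"
    using W.finitely_generated_indexed[OF finitely_generated_W[OF assms(3,4)]] by blast
  show ?thesis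
  proof
    assume "\<exists>k\<ge>2. preforms W (free_group k)"
    then obtain k where k: "2 \<le> k" "\<not> (\<exists>w. is_almost_identity W k w)"
      using preforms_iff by blast
    \<comment> \<open>If both conditions failed, an identity of \<open>G\<close> and an
      almost-identity of \<open>H\<close> for this same \<open>k\<close> would combine into one of
      the wreath product.\<close>
    then show "\<not> satisfies_identity G \<or> \<not> satisfies_almost_identity H"
      using ex_almost_identity unfolding satisfies_identity_def satisfies_almost_identity_def by blast
  next
    assume "\<not> satisfies_identity G \<or> \<not> satisfies_almost_identity H"
    then show "\<exists>k\<ge>2. preforms W (free_group k)"
    proof
      assume ni: "\<not> satisfies_identity G"
      obtain hs r where "generating_set H (hs ` {..<r::nat})"
        using H.finitely_generated_indexed[OF assms(4)] by blast
      moreover obtain gs d where "generating_set G (gs ` {..<d::nat})"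
        using G.finitely_generated_indexed[OF assms(3)] by blast
      ultimately have "\<not> (\<exists>w. is_almost_identity W (N + r + d) w)"
        using not_almost_identity_if_no_identity[OF assms(5) ni s(2)] by blast
      with s(1) show ?thesis using preforms_iff[of "N + r + d"] by (intro exI[of _ "N + r + d"]) simp
    next
      assume "\<not> satisfies_almost_identity H"
      then obtain k where k: "2 \<le> k" "\<not> (\<exists>w. is_almost_identity H k w)"
        by (auto simp: satisfies_almost_identity_def)
      then have "\<not> (\<exists>w. is_almost_identity W (k + N) w)"
        using not_almost_identity_lift[OF snd_group_hom snd_surj s(2)] by blast
      with k(1) show ?thesis using preforms_iff[of "k + N"] by (intro exI[of _ "k + N"]) simp
    qed
  qed
qed

end
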